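(* Let $F, G$ be symmetric $2 \times 2$ matrices with entries in the univariate polynomial ring $\mathbb{R}[x]$ satisfying (B1) for every $a \in \mathbb{R}$ and every nonzero $v \in \mathbb{R}^2$ such that $v^T G(a) v \ge 0$ we have $v^T F(a) v > 0$. Then they also satisfy (B3) there exists $s \in \sum \mathbb{R}[x]^2$ such that $(1+s)F \in I_2 + \mathrm{Pos}(K_G) \cdot N_G$.
   Context: $\sum \mathbb{R}[x]^2$ is the set of all finite sums of squares of polynomials in $\mathbb{R}[x]$, and $\sum \mathrm{M}_2(\mathbb{R}[x])^2$ is the set of all finite sums of matrices $H^T H$ with $H$ a $2\times 2$ matrix over $\mathbb{R}[x]$. $N_G = \{ S + \sigma G : S \in \sum \mathrm{M}_2(\mathbb{R}[x])^2,\ \sigma \in \sum \mathbb{R}[x]^2\}$. $K_G = \{a \in \mathbb{R} : v^T G(a) v \ge 0 \text{ for some nonzero } v \in \mathbb{R}^2\}$. $\mathrm{Pos}(K) = \{f \in \mathbb{R}[x] : f(a) \ge 0 \text{ for all } a \in K\}$. For a set $A$ of polynomials and a set $B$ of symmetric matrix polynomials, $A \cdot B$ is the set of all finite sums $\sum_i a_i b_i$ with $a_i \in A$, $b_i \in B$. $I_2$ is the identity matrix and $I_2 + X = \{I_2 + H : H \in X\}$. *)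

theory Defs
  imports "HOL-Analysis.Analysis" "HOL-Computational_Algebra.Polynomial"
begin

type_synonym polymat2 = "real poly ^ 2 ^ 2"

definition mat_eval :: "polymat2 \<Rightarrow> real \<Rightarrow> real ^ 2 ^ 2" where
  "mat_eval A a = map_matrix (\<lambda>p. poly p a) A"

definition quad_form :: "real ^ 2 ^ 2 \<Rightarrow> real ^ 2 \<Rightarrow> real" where
  "quad_form M v = v \<bullet> (M *v v)"

definition poly_scale :: "real poly \<Rightarrow> polymat2 \<Rightarrow> polymat2"  (infixr \<open>*\<^sub>p\<close> 75) where
  "f *\<^sub>p A = map_matrix ((*) f) A"

definition sos_poly :: "real poly set" where
  "sos_poly = {\<Sum>i<n. (h i)\<^sup>2 | (n::nat) h. True}"

definition sos_mat :: "polymat2 set" where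
  "sos_mat = {\<Sum>i<n. transpose (H i) ** H i | (n::nat) (H :: nat \<Rightarrow> polymat2). True}"

definition N_set :: "polymat2 \<Rightarrow> polymat2 set" where
  "N_set G = {S + \<sigma> *\<^sub>p G | S \<sigma>. S \<in> sos_mat \<and> \<sigma> \<in> sos_poly}"

definition K_set :: "polymat2 \<Rightarrow> real set" where
  "K_set G = {a. \<exists>v. v \<noteq> 0 \<and> quad_form (mat_eval G a) v \<ge> 0}"

definition Pos :: "real set \<Rightarrow> real poly set" where
  "Pos K = {f. \<forall>a\<in>K. poly f a \<ge> 0}"

text \<open>Not the pointwise product of sets: finite sums of products are taken.\<close>

definition set_prod :: "real poly set \<Rightarrow> polymat2 set \<Rightarrow> polymat2 set" where
  "set_prod A B = {\<Sum>i<n. a i *\<^sub>p b i | (n::nat) a b. \<forall>i<n. a i \<in> A \<and> b i \<in> B}"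

end

theory Submission
  imports Defs
begin

text \<open>On \<open>K\<close>, the set where \<open>G\<close> is not negative definite, one looks for polynomials \<open>q > 0\<close> and
  \<open>p \<ge> 0\<close> with \<open>q F - p G\<close> positive definite. At a single point they exist by the S-lemma.
  Pointwise solutions form a convex cone, so local solutions over neighbouring intervals are glued with
  weights \<open>u ^ n\<close>, where \<open>u\<close> crosses the value 1 in the overlap and \<open>n\<close> is large. The delicate point is
  a common solution near both ends of the line, since a rational function \<open>p / q\<close> behaves alike at both.
  There the admissible \<open>l = p / q\<close> are cut out by the roots of \<open>det (F - l G)\<close>, the same quadratic
  polynomial at both ends. In the only nontrivial case \<open>l\<close> must lie just below a root at one end and
  just above it at the other, and an approximate square root of the discriminant whose error
  has odd degree achieves this.

  For \<open>X = q F - p G\<close> the adjugate identities then place \<open>f X - I\<close> in the cone for a nonnegative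
  multiplier \<open>f\<close> that vanishes only where \<open>X\<close> does. Since \<open>q F - p G\<close> and \<open>q F - (p + 1) G\<close> have no
  common zero, adding both certificates gives a positive multiplier of \<open>F\<close>, and nonnegative
  polynomials in one variable are sums of squares.\<close>

subsection \<open>Pencils of real binary quadratic forms\<close>

definition qf :: "real \<Rightarrow> real \<Rightarrow> real \<Rightarrow> real \<Rightarrow> real \<Rightarrow> real" where
  "qf a b c x y = a * x\<^sup>2 + 2 * b * x * y + c * y\<^sup>2"

definition pd :: "real \<Rightarrow> real \<Rightarrow> real \<Rightarrow> bool" where
  "pd a b c \<longleftrightarrow> 0 < a \<and> 0 < a * c - b\<^sup>2"

lemma sum_squares_pos: "x \<noteq> 0 \<or> y \<noteq> 0 \<Longrightarrow> 0 < x\<^sup>2 + (y::real)\<^sup>2"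
  by (simp add: sum_power2_gt_zero_iff)

lemma pd_pos:
  assumes "pd a b c" shows "0 < a" "0 < c" "0 < a + c" "0 < a * c - b\<^sup>2"
proof -
  show a: "0 < a" and d: "0 < a * c - b\<^sup>2" using assms by (auto simp: pd_def)
  have "0 < a * c" using d zero_le_power2[of b] by linarith
  then show c: "0 < c" using a by (simp add: zero_less_mult_iff)
  show "0 < a + c" using a c by simp
qed

text \<open>Cayley-Hamilton: the matrix A of the form satisfies tr(A) A = A^2 + det(A) I, and A^2
  contributes the squared length of A (x, y). Definiteness thus gets a lower bound in terms of trace
  and determinant.\<close>

lemma qf_lower_bound:
  assumes "pd a b c"
  shows "(a * c - b\<^sup>2) * (x\<^sup>2 + y\<^sup>2) \<le> (a + c) * qf a b c x y"
proof -
  have "(a + c) * qf a b c x y - (a * c - b\<^sup>2) * (x\<^sup>2 + y\<^sup>2) = (a*x + b*y)\<^sup>2 + (b*x + c*y)\<^sup>2"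
    unfolding qf_def by algebra
  then show ?thesis using sum_power2_ge_zero[of "a*x + b*y" "b*x + c*y"] by linarith
qed

lemma qf_pos:
  assumes "pd a b c" "x \<noteq> 0 \<or> y \<noteq> 0" shows "0 < qf a b c x y"
proof -
  have "0 < (a * c - b\<^sup>2) * (x\<^sup>2 + y\<^sup>2)"
    using pd_pos[OF assms(1)] sum_squares_pos[OF assms(2)] by simp
  then have "0 < (a + c) * qf a b c x y" using qf_lower_bound[OF assms(1), of x y] by linarith
  then show ?thesis using pd_pos(3)[OF assms(1)] by (simp add: zero_less_mult_iff)
qed

lemma qf_nonneg: "pd a b c \<Longrightarrow> 0 \<le> qf a b c x y"
  using qf_pos[of a b c x y] by (cases "x = 0 \<and> y = 0") (auto simp: qf_def intro: less_imp_le)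

lemma abs_le_one_plus_square: "\<bar>u\<bar> \<le> 1 + (u::real)\<^sup>2"
proof -
  have "2 * u \<le> 1 + u\<^sup>2" "- (2 * u) \<le> 1 + u\<^sup>2"
    using zero_le_power2[of "u - 1"] zero_le_power2[of "u + 1"]
    by (simp_all add: power2_eq_square algebra_simps)
  then show ?thesis by linarith
qed

lemma qf_bound: "\<bar>qf a b c x y\<bar> \<le> (3 + a\<^sup>2 + b\<^sup>2 + c\<^sup>2) * (x\<^sup>2 + y\<^sup>2)"
proof -
  have xy: "\<bar>2 * x * y\<bar> \<le> x\<^sup>2 + y\<^sup>2"
    using sum_squares_bound[of x y] sum_squares_bound[of "-x" y] by (auto simp: abs_le_iff)
  have "\<bar>qf a b c x y\<bar> \<le> \<bar>a * x\<^sup>2\<bar> + \<bar>b * (2 * x * y)\<bar> + \<bar>c * y\<^sup>2\<bar>"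
    unfolding qf_def by (simp add: algebra_simps)
  also have "\<dots> = \<bar>a\<bar> * x\<^sup>2 + \<bar>b\<bar> * \<bar>2 * x * y\<bar> + \<bar>c\<bar> * y\<^sup>2" by (simp add: abs_mult)
  also have "\<dots> \<le> (1 + a\<^sup>2) * (x\<^sup>2 + y\<^sup>2) + (1 + b\<^sup>2) * (x\<^sup>2 + y\<^sup>2) + (1 + c\<^sup>2) * (x\<^sup>2 + y\<^sup>2)"
    by (intro add_mono mult_mono abs_le_one_plus_square xy) auto
  also have "\<dots> = (3 + a\<^sup>2 + b\<^sup>2 + c\<^sup>2) * (x\<^sup>2 + y\<^sup>2)" by algebra
  finally show ?thesis .
qed

text \<open>A binary form with positive determinant is definite, so one positive value decides its
  sign.\<close>

lemma pdI:
  assumes "0 < a * c - b\<^sup>2" "0 < qf a b c x y" shows "pd a b c"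
proof -
  have eq: "a * qf a b c x y = (a*x + b*y)\<^sup>2 + (a * c - b\<^sup>2) * y\<^sup>2" unfolding qf_def by algebra
  have "0 \<le> a * qf a b c x y" unfolding eq using assms(1) by simp
  then have "0 \<le> a" using assms(2) by (simp add: zero_le_mult_iff)
  moreover have "a \<noteq> 0" using assms(1) by (metis diff_0 less_numeral_extra(3) mult_zero_left neg_0_less_iff_less not_sum_power2_lt_zero power_zero_numeral zero_le_power2 leD)
  ultimately show ?thesis using assms(1) by (simp add: pd_def)
qed

lemma pd_iff: "pd a b c \<longleftrightarrow> (\<forall>x y. x \<noteq> 0 \<or> y \<noteq> 0 \<longrightarrow> 0 < qf a b c x y)"
proof
  assume *: "\<forall>x y. x \<noteq> 0 \<or> y \<noteq> 0 \<longrightarrow> 0 < qf a b c x y"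
  have a: "0 < a" using *[rule_format, of 1 0] by (simp add: qf_def)
  have "0 < qf a b c (-b) a" using * a by simp
  moreover have "qf a b c (-b) a = a * (a * c - b\<^sup>2)" unfolding qf_def by algebra
  ultimately show "pd a b c" using a by (simp add: pd_def zero_less_mult_iff)
qed (use qf_pos in blast)

text \<open>The left side fails exactly when the negated form is positive definite. This turns the
  existential description of \<open>K_set\<close> into polynomial inequalities.\<close>

lemma qf_nonneg_somewhere_iff:
  "(\<exists>x y. (x \<noteq> 0 \<or> y \<noteq> 0) \<and> 0 \<le> qf a b c x y) \<longleftrightarrow> 0 \<le> a \<or> a * c - b\<^sup>2 \<le> 0"
proof -
  have "qf (-a) (-b) (-c) x y = - qf a b c x y" for x y by (simp add: qf_def)
  then have "pd (-a) (-b) (-c) \<longleftrightarrow> \<not> (\<exists>x y. (x \<noteq> 0 \<or> y \<noteq> 0) \<and> 0 \<le> qf a b c x y)"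
    unfolding pd_iff by (metis neg_0_less_iff_less not_le)
  moreover have "pd (-a) (-b) (-c) \<longleftrightarrow> \<not> (0 \<le> a \<or> a * c - b\<^sup>2 \<le> 0)" by (auto simp: pd_def)
  ultimately show ?thesis by blast
qed

lemma exists_null_vector:
  assumes "a * c - b\<^sup>2 \<le> 0"
  obtains x y where "x \<noteq> 0 \<or> y \<noteq> 0" "qf a b c x y = 0"
proof (cases "a = 0")
  case True
  then show ?thesis using that[of 1 0] by (simp add: qf_def)
next
  case False
  define s where "s = sqrt (b\<^sup>2 - a * c)"
  have s: "s\<^sup>2 = b\<^sup>2 - a * c" using assms by (simp add: s_def)
  have "qf a b c (s - b) a = a * (s\<^sup>2 - (b\<^sup>2 - a * c))" unfolding qf_def by algebra
  then show ?thesis using that[of "s - b" a] False s by simp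
qed

lemma exists_null_basis:
  assumes "a * c - b\<^sup>2 < 0"
  obtains x y z w where "qf a b c x y = 0" "qf a b c z w = 0" "x * w - y * z \<noteq> 0"
proof (cases "a = 0")
  case True
  then have "b \<noteq> 0" using assms by auto
  then show ?thesis using that[of 1 0 "-c" "2 * b"] True by (simp add: qf_def power2_eq_square)
next
  case False
  define s where "s = sqrt (b\<^sup>2 - a * c)"
  have s: "s\<^sup>2 = b\<^sup>2 - a * c" and s0: "s > 0" using assms by (auto simp: s_def)
  have "qf a b c (s - b) a = a * (s\<^sup>2 - (b\<^sup>2 - a * c))" unfolding qf_def by algebra
  moreover have "qf a b c (- s - b) a = a * (s\<^sup>2 - (b\<^sup>2 - a * c))" unfolding qf_def by algebra
  moreover have "(s - b) * a - a * (- s - b) = 2 * a * s" by algebra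
  ultimately show ?thesis using that[of "s - b" a "- s - b" a] False s s0 by simp
qed

text \<open>The mixed discriminant is minus the linear coefficient of det (F - l G) in l. The second
  inequality says that this quadratic has real roots.\<close>

lemma mixed_discriminant:
  assumes "pd a b c" "pd a' b' c'"
  shows "0 < a * c' + c * a' - 2 * b * b'" (is "0 < ?t")
    and "4 * (a * c - b\<^sup>2) * (a' * c' - b'\<^sup>2) \<le> (a * c' + c * a' - 2 * b * b')\<^sup>2"
proof -
  let ?f = "a * c - b\<^sup>2" and ?g = "a' * c' - b'\<^sup>2"
  have p: "0 < a" "0 < ?f" "0 < a'" "0 < ?g" using assms by (auto simp: pd_def)
  have eq: "?f * a'\<^sup>2 + ?g * a\<^sup>2 + (b * a' - b' * a)\<^sup>2 = a * a' * ?t" by algebra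
  have "0 < a * a' * ?t" unfolding eq[symmetric] using p by (simp add: add_pos_pos add_pos_nonneg)
  then show t: "0 < ?t" using p by (metis mult_pos_pos zero_less_mult_pos)
  \<comment> \<open>The quadratic \<open>g z^2 - t a' z + f a'^2\<close> in z has discriminant
    \<open>a'^2 (t^2 - 4 f g)\<close>. By \<open>eq\<close> its value at z = a is at most 0;
    completing the square there gives the claim.\<close>
  have "(2 * ?g * a - ?t * a')\<^sup>2 - a'\<^sup>2 * (?t\<^sup>2 - 4 * ?f * ?g) = 4 * ?g * (?f * a'\<^sup>2 + ?g * a\<^sup>2 - a * a' * ?t)"
    by algebra
  also have "\<dots> = - 4 * ?g * (b * a' - b' * a)\<^sup>2" unfolding eq[symmetric] by algebra
  also have "\<dots> \<le> 0" using p(4) by (intro mult_nonpos_nonneg) auto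
  finally have "0 \<le> a'\<^sup>2 * (?t\<^sup>2 - 4 * ?f * ?g)" using zero_le_power2[of "2 * ?g * a - ?t * a'"] by linarith
  then show "4 * ?f * ?g \<le> ?t\<^sup>2" using p by (simp add: zero_le_mult_iff)
qed

text \<open>With f = det F, g = det G and t the mixed discriminant, \<open>f - t l + g l^2\<close>
  is det (F - l G). For g > 0, l = 0 is admissible, and the inequalities say that both roots are
  real and positive.\<close>

definition pencil_ok :: "real \<Rightarrow> real \<Rightarrow> real \<Rightarrow> bool" where
  "pencil_ok f t g \<longleftrightarrow>
     (g \<le> 0 \<and> (\<exists>l\<ge>0. 0 < f - t * l + g * l\<^sup>2)) \<or> (0 < g \<and> 0 < f \<and> 0 < t \<and> 4 * f * g \<le> t\<^sup>2)"

text \<open>The S-lemma for indefinite G. In a basis of null vectors of G the matrices become F =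
  [[A, M], [M, C]] with A, C > 0 and G = [[0, N], [N, 0]], so det (F - l G) is
  \<open>A C - (M - l N)^2\<close> up to a positive factor. It is largest at l = M / N; if that is
  negative, l = 0 works.\<close>

lemma indefinite_pencil_ok:
  assumes B: "\<And>x y. x \<noteq> 0 \<or> y \<noteq> 0 \<Longrightarrow> 0 \<le> qf a' b' c' x y \<Longrightarrow> 0 < qf a b c x y"
    and g: "a' * c' - b'\<^sup>2 < 0"
  shows "\<exists>l\<ge>0. 0 < (a * c - b\<^sup>2) - (a * c' + c * a' - 2 * b * b') * l + (a' * c' - b'\<^sup>2) * l\<^sup>2"
    (is "\<exists>l\<ge>0. 0 < ?phi l")
proof -
  obtain x y z w where n: "qf a' b' c' x y = 0" "qf a' b' c' z w = 0" and d: "x * w - y * z \<noteq> 0"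
    using exists_null_basis[OF g] .
  define A where "A = qf a b c x y"
  define C where "C = qf a b c z w"
  define M where "M = a * x * z + b * (x * w + y * z) + c * y * w"
  define N where "N = a' * x * z + b' * (x * w + y * z) + c' * y * w"
  have A: "0 < A" unfolding A_def by (rule B) (use d n in auto)
  have C: "0 < C" unfolding C_def by (rule B) (use d n in auto)
  have comb: "qf a b c (r*x + s*z) (r*y + s*w) = A * r\<^sup>2 + 2 * r * s * M + C * s\<^sup>2" for r s
    unfolding A_def C_def M_def qf_def by algebra
  have comb': "qf a' b' c' (r*x + s*z) (r*y + s*w) = 2 * r * s * N" for r s
  proof -
    have "qf a' b' c' (r*x + s*z) (r*y + s*w)
      = qf a' b' c' x y * r\<^sup>2 + 2 * r * s * N + qf a' b' c' z w * s\<^sup>2"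
      unfolding N_def qf_def by algebra
    then show ?thesis using n by simp
  qed
  have phi: "?phi l * (x * w - y * z)\<^sup>2 = A * C - (M - l * N)\<^sup>2" for l
  proof -
    have "?phi l * (x * w - y * z)\<^sup>2
      = (A - l * qf a' b' c' x y) * (C - l * qf a' b' c' z w) - (M - l * N)\<^sup>2"
      unfolding A_def C_def M_def N_def qf_def by algebra
    then show ?thesis using n by simp
  qed
  have pos: "0 < ?phi l" if "0 < A * C - (M - l * N)\<^sup>2" for l
    using that phi[of l] d by (metis zero_less_mult_pos2 zero_less_power2)
  have AC: "0 < A * C" using A C by simp
  have "N \<noteq> 0"
  proof
    assume "N = 0"
    then have "0 = (a' * c' - b'\<^sup>2) * (x * w - y * z)\<^sup>2"
    proof -
      have "(a' * c' - b'\<^sup>2) * (x * w - y * z)\<^sup>2 = qf a' b' c' x y * qf a' b' c' z w - N\<^sup>2"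
        unfolding N_def qf_def by algebra
      then show ?thesis using n \<open>N = 0\<close> by simp
    qed
    then show False using g d by simp
  qed
  show ?thesis
  proof (cases "0 \<le> M / N")
    case True
    have "0 < ?phi (M / N)" by (rule pos) (use AC \<open>N \<noteq> 0\<close> in simp)
    then show ?thesis using True by blast
  next
    case False
    then have MN: "M * N < 0" by (auto simp: not_le divide_less_0_iff mult_less_0_iff)
    \<comment> \<open>With r^2 = C and s^2 = A the two square terms agree and F takes the value
      \<open>2 (A C + r s M)\<close>. The sign of s makes G positive and r s M negative, so
      positivity of F forces M^2 < A C.\<close>
    define s where "s = sgn N * sqrt A"
    define r where "r = sqrt C"
    have rs: "r\<^sup>2 = C" "s\<^sup>2 = A" using A C \<open>N \<noteq> 0\<close> by (auto simp: r_def s_def power_mult_distrib sgn_if)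
    have "r > 0" using C by (simp add: r_def)
    have "0 < s * N" using A \<open>N \<noteq> 0\<close> by (auto simp: s_def sgn_if mult_neg_pos zero_less_mult_iff)
    then have sM: "s * M < 0" using MN by (auto simp: zero_less_mult_iff mult_less_0_iff)
    have nz: "r*x + s*z \<noteq> 0 \<or> r*y + s*w \<noteq> 0"
    proof (rule ccontr)
      assume "\<not> ?thesis"
      then have "r*x + s*z = 0" "r*y + s*w = 0" by auto
      then have "r * (x * w - y * z) = 0" by algebra
      then show False using \<open>r > 0\<close> d by simp
    qed
    have "0 < qf a b c (r*x + s*z) (r*y + s*w)"
      by (rule B[OF nz]) (use comb' \<open>0 < s * N\<close> \<open>r > 0\<close> in \<open>simp add: mult.assoc\<close>)
    then have "0 < 2 * (A * C + r * (s * M))" unfolding comb using rs by (simp add: algebra_simps)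
    then have "r * (s * M) > - (A * C)" by simp
    moreover have "r * (s * M) < 0" using \<open>r > 0\<close> sM by (simp add: mult_pos_neg)
    ultimately have "(r * (s * M))\<^sup>2 < (A * C)\<^sup>2"
      by (metis AC abs_if abs_of_pos minus_less_iff power2_less_imp_less power2_abs power_strict_mono abs_ge_zero zero_less_numeral)
    moreover have "(r * (s * M))\<^sup>2 = (A * C) * M\<^sup>2"
      using rs by (simp add: power_mult_distrib)
    ultimately have "(A * C) * M\<^sup>2 < (A * C) * (A * C)" by (simp only: power2_eq_square[of "A * C"])
    then have "M\<^sup>2 < A * C" using AC by (metis mult_less_cancel_left_pos)
    then have "0 < ?phi 0" by (intro pos) simp
    then show ?thesis by blast
  qed
qed

text \<open>A nonzero semidefinite G of determinant 0 that is nonpositive is the delicate case: then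
  t < 0, so a large l works. If G is positive definite or nonnegative, F is positive definite; the
  indefinite case is done above.\<close>

lemma pencil_ok_if_positive:
  assumes B: "\<And>x y. x \<noteq> 0 \<or> y \<noteq> 0 \<Longrightarrow> 0 \<le> qf a' b' c' x y \<Longrightarrow> 0 < qf a b c x y"
    and K: "0 \<le> a' \<or> a' * c' - b'\<^sup>2 \<le> 0"
  shows "pencil_ok (a * c - b\<^sup>2) (a * c' + c * a' - 2 * b * b') (a' * c' - b'\<^sup>2)"
    (is "pencil_ok ?f ?t ?g")
proof -
  consider "?g < 0" | "0 < ?g" | "?g = 0" "0 \<le> a' + c'" | "?g = 0" "a' + c' < 0" by linarith
  then show ?thesis
  proof cases
    case 1
    then show ?thesis using indefinite_pencil_ok[OF B 1] by (auto simp: pencil_ok_def)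
  next
    case 2
    then have "0 \<le> a'" "a' \<noteq> 0" using K by auto
    then have G: "pd a' b' c'" using 2 by (simp add: pd_def)
    have F: "pd a b c" unfolding pd_iff using B qf_nonneg[OF G] by blast
    show ?thesis using mixed_discriminant[OF F G] pd_pos(4)[OF F] 2 by (simp add: pencil_ok_def)
  next
    case 3
    have "0 \<le> a' * c'" using 3 by (metis add.commute diff_eq_eq add_0 zero_le_power2)
    then have ac: "0 \<le> a'" "0 \<le> c'" using 3 by (auto simp: zero_le_mult_iff)
    have "0 \<le> qf a' b' c' x y" for x y
    proof -
      have "(a' + c') * qf a' b' c' x y - ?g * (x\<^sup>2 + y\<^sup>2) = (a'*x + b'*y)\<^sup>2 + (b'*x + c'*y)\<^sup>2"
        unfolding qf_def by algebra
      then have "0 \<le> (a' + c') * qf a' b' c' x y" using 3 by simp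
      moreover have "qf a' b' c' x y = 0" if "a' + c' = 0"
      proof -
        have "a' = 0" "c' = 0" using that ac by linarith+
        then show ?thesis using 3 by (simp add: qf_def)
      qed
      ultimately show ?thesis using 3(2) by (cases "a' + c' = 0") (auto simp: zero_le_mult_iff)
    qed
    then have "pd a b c" unfolding pd_iff using B by blast
    then show ?thesis unfolding pencil_ok_def using 3 pd_pos(4) by (intro disjI1 conjI exI[of _ 0]) auto
  next
    case 4
    have ge: "0 \<le> a' * c'" using 4 by (metis add.commute diff_eq_eq add_0 zero_le_power2)
    then have ac: "a' \<le> 0" "c' \<le> 0" using 4 by (auto simp: zero_le_mult_iff)
    have b2: "b'\<^sup>2 = a' * c'" using 4 by simp
    \<comment> \<open>The vectors (-b', a') and (c', -b') lie in the kernel of G and are not both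
      zero. F is positive on a nonzero one, with value a' t or c' t.\<close>
    have t: "?t < 0"
    proof (cases "a' = 0")
      case False
      have "qf a' b' c' (-b') a' = a' * ?g" unfolding qf_def by algebra
      then have "0 < qf a b c (-b') a'" using 4 False by (intro B) auto
      moreover have "qf a b c (-b') a' = a' * ?t" using b2 unfolding qf_def by algebra
      ultimately show ?thesis using ac by (simp add: zero_less_mult_iff)
    next
      case True
      have "qf a' b' c' c' (-b') = c' * ?g" unfolding qf_def by algebra
      then have "0 < qf a b c c' (-b')" using 4 True by (intro B) auto
      moreover have "qf a b c c' (-b') = c' * ?t" using b2 unfolding qf_def by algebra
      ultimately show ?thesis using ac by (simp add: zero_less_mult_iff)
    qed
    define l where "l = (\<bar>?f\<bar> + 1) / (- ?t)"
    have "?t * l = - (\<bar>?f\<bar> + 1)"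
      unfolding l_def using less_imp_neq[OF t] by (metis minus_divide_right mult_minus_right nonzero_mult_div_cancel_left times_divide_eq_right)
    then have "0 < ?f - ?t * l + ?g * l\<^sup>2" using 4 by (simp only: mult_zero_left)
    moreover have "0 \<le> l" using t by (simp add: l_def divide_nonneg_neg)
    ultimately show ?thesis unfolding pencil_ok_def using 4 by (intro disjI1 conjI exI[of _ l]) auto
  qed
qed

text \<open>Positivity of the determinant leaves only the sign of q F - p G open. If G has a null
  vector, F is positive there. Otherwise G is positive definite, and \<open>side\<close> says that q
  F - p G has positive mixed discriminant with G, so it is not negative definite.\<close>

lemma pencil_pd:
  assumes B: "\<And>x y. x \<noteq> 0 \<or> y \<noteq> 0 \<Longrightarrow> 0 \<le> qf a' b' c' x y \<Longrightarrow> 0 < qf a b c x y"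
    and K: "0 \<le> a' \<or> a' * c' - b'\<^sup>2 \<le> 0"
    and q: "0 < q"
    and phi: "0 < (a * c - b\<^sup>2) * q\<^sup>2 - (a * c' + c * a' - 2 * b * b') * q * p + (a' * c' - b'\<^sup>2) * p\<^sup>2"
    and side: "a' * c' - b'\<^sup>2 \<le> 0 \<or> 2 * (a' * c' - b'\<^sup>2) * p < (a * c' + c * a' - 2 * b * b') * q"
  shows "pd (q * a - p * a') (q * b - p * b') (q * c - p * c')"
proof -
  let ?g = "a' * c' - b'\<^sup>2"
  have det: "0 < (q * a - p * a') * (q * c - p * c') - (q * b - p * b')\<^sup>2"
    using phi by (simp add: power2_eq_square algebra_simps)
  have lin: "qf (q * a - p * a') (q * b - p * b') (q * c - p * c') x y = q * qf a b c x y - p * qf a' b' c' x y" for x y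
    unfolding qf_def by algebra
  show ?thesis
  proof (cases "?g \<le> 0")
    case True
    then obtain x y where xy: "x \<noteq> 0 \<or> y \<noteq> 0" "qf a' b' c' x y = 0" by (rule exists_null_vector)
    then have "0 < qf a b c x y" using B by simp
    then show ?thesis by (intro pdI[OF det, of x y]) (simp add: lin xy q)
  next
    case False
    then have G: "pd a' b' c'" using K by (cases "a' = 0") (auto simp: pd_def)
    show ?thesis
    proof (rule ccontr)
      assume "\<not> ?thesis"
      then have "q * a - p * a' \<le> 0" using det by (simp add: pd_def not_less)
      moreover have "q * a - p * a' \<noteq> 0" using det
        by (metis diff_0 less_numeral_extra(3) mult_zero_left neg_0_less_iff_less zero_le_power2 leD)
      ultimately have "pd (- (q * a - p * a')) (- (q * b - p * b')) (- (q * c - p * c'))"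
        unfolding pd_def minus_mult_minus power2_minus using det by (simp add: less_le)
      from mixed_discriminant(1)[OF this G] side False show False
        by (simp add: power2_eq_square algebra_simps)
    qed
  qed
qed

subsection \<open>Real polynomials in one variable\<close>

lemma eventually_at_bot_uminus:
  "eventually P at_bot \<longleftrightarrow> eventually (\<lambda>x. P (- x)) (at_top :: real filter)"
  by (simp add: at_bot_mirror eventually_filtermap)

lemma poly_pos_at_top_iff:
  fixes f :: "real poly"
  shows "(\<forall>\<^sub>F x in at_top. 0 < poly f x) \<longleftrightarrow> 0 < lead_coeff f"
proof
  assume L: "0 < lead_coeff f"
  from poly_pinfty_gt_lc[OF this] obtain n where "\<forall>x\<ge>n. lead_coeff f \<le> poly f x" by blast
  with L show "\<forall>\<^sub>F x in at_top. 0 < poly f x"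
    unfolding eventually_at_top_linorder by (meson less_le_trans)
next
  assume *: "\<forall>\<^sub>F x in at_top. 0 < poly f x"
  show "0 < lead_coeff f"
  proof (rule ccontr)
    assume L: "\<not> 0 < lead_coeff f"
    have "\<forall>\<^sub>F x in at_top. poly f x \<le> 0"
    proof (cases "f = 0")
      case False
      then have "0 < lead_coeff (- f)" using L by (simp add: less_le not_less)
      from poly_pinfty_gt_lc[OF this] obtain n where "\<forall>x\<ge>n. lead_coeff (- f) \<le> poly (- f) x" by blast
      with \<open>0 < lead_coeff (- f)\<close> show ?thesis
        unfolding eventually_at_top_linorder by (intro exI[of _ n]) fastforce
    qed simp
    with * have "\<forall>\<^sub>F x in at_top. 0 < poly f x \<and> poly f x \<le> 0" by (rule eventually_conj)
    then have "\<exists>x. 0 < poly f x \<and> poly f x \<le> 0" by (rule eventually_happens'[rotated]) simp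
    then show False by auto
  qed
qed

abbreviation refl_poly :: "real poly \<Rightarrow> real poly" where
  "refl_poly f \<equiv> pcompose f [:0, -1:]"

lemma poly_refl_poly: "poly (refl_poly f) x = poly f (- x)"
  by (simp add: poly_pcompose)

lemma poly_pos_at_bot_iff:
  fixes f :: "real poly"
  shows "(\<forall>\<^sub>F x in at_bot. 0 < poly f x) \<longleftrightarrow> 0 < (-1) ^ degree f * lead_coeff f"
proof -
  have "lead_coeff (refl_poly f) = lead_coeff f * (-1) ^ degree f"
    by (subst lead_coeff_comp) auto
  then show ?thesis
    using poly_pos_at_top_iff[of "refl_poly f"]
    by (simp add: eventually_at_bot_uminus poly_refl_poly mult.commute)
qed

lemma poly_sign_at_top:
  fixes f :: "real poly"
  shows "f = 0 \<or> (\<forall>\<^sub>F x in at_top. 0 < poly f x) \<or> (\<forall>\<^sub>F x in at_top. poly f x < 0)"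
  using poly_pos_at_top_iff[of f] poly_pos_at_top_iff[of "- f"]
  by (auto simp: not_less less_le)

lemma poly_sign_at_bot:
  fixes f :: "real poly"
  shows "f = 0 \<or> (\<forall>\<^sub>F x in at_bot. 0 < poly f x) \<or> (\<forall>\<^sub>F x in at_bot. poly f x < 0)"
  using poly_sign_at_top[of "refl_poly f"]
  by (auto simp: eventually_at_bot_uminus poly_refl_poly pcompose_eq_0_iff)

lemma poly_pos_decided:
  fixes f :: "real poly"
  assumes "F = at_top \<or> F = at_bot"
  shows "(\<forall>\<^sub>F x in F. 0 < poly f x) \<or> (\<forall>\<^sub>F x in F. \<not> 0 < poly f x)"
proof (cases "f = 0")
  case False
  then consider "\<forall>\<^sub>F x in F. 0 < poly f x" | "\<forall>\<^sub>F x in F. poly f x < 0"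
    using assms poly_sign_at_top[of f] poly_sign_at_bot[of f] by blast
  then show ?thesis
  proof cases
    case 2
    then have "\<forall>\<^sub>F x in F. \<not> 0 < poly f x" by (rule eventually_mono) auto
    then show ?thesis ..
  qed simp
qed simp

lemma poly_eventually_nonzero:
  fixes f :: "real poly"
  assumes "f \<noteq> 0" "F = at_top \<or> F = at_bot"
  shows "\<forall>\<^sub>F x in F. poly f x \<noteq> 0"
proof -
  consider "\<forall>\<^sub>F x in F. 0 < poly f x" | "\<forall>\<^sub>F x in F. poly f x < 0"
    using assms poly_sign_at_top[of f] poly_sign_at_bot[of f] by blast
  then show ?thesis by cases (auto elim: eventually_mono)
qed

lemma eventually_decided_conj:
  assumes "(\<forall>\<^sub>F x in F. P x) \<or> (\<forall>\<^sub>F x in F. \<not> P x)" "(\<forall>\<^sub>F x in F. Q x) \<or> (\<forall>\<^sub>F x in F. \<not> Q x)"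
  shows "(\<forall>\<^sub>F x in F. P x \<and> Q x) \<or> (\<forall>\<^sub>F x in F. \<not> (P x \<and> Q x))"
proof (cases "(\<forall>\<^sub>F x in F. P x) \<and> (\<forall>\<^sub>F x in F. Q x)")
  case True
  then show ?thesis by (simp add: eventually_conj)
next
  case False
  then consider "\<forall>\<^sub>F x in F. \<not> P x" | "\<forall>\<^sub>F x in F. \<not> Q x" using assms by blast
  then have "\<forall>\<^sub>F x in F. \<not> (P x \<and> Q x)" by cases (auto elim: eventually_mono)
  then show ?thesis ..
qed

text \<open>A nonconstant polynomial is at least 1 in absolute value far out, so only a compact
  piece of X can bring it near 0, and there the minimum is attained.\<close>

lemma poly_pos_closed_lower_bound:
  fixes f :: "real poly"
  assumes X: "closed X" and f: "\<And>x. x \<in> X \<Longrightarrow> 0 < poly f x"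
  obtains d where "0 < d" "\<And>x. x \<in> X \<Longrightarrow> d \<le> poly f x"
proof (cases "degree f = 0")
  case True
  then obtain c where c: "f = [:c:]" by (rule degree_eq_zeroE)
  show ?thesis
  proof (cases "X = {}")
    case True then show ?thesis using that[of 1] by simp
  next
    case False then show ?thesis using that[of c] f c by auto
  qed
next
  case False
  then have "filterlim (poly f) at_infinity at_infinity"
    by (intro filterlim_poly_at_infinity) simp
  then have "\<forall>\<^sub>F x in at_infinity. 1 \<le> norm (poly f x)"
    by (subst (asm) filterlim_at_infinity[where c=0]) auto
  then obtain b where b: "\<And>x. b \<le> norm x \<Longrightarrow> 1 \<le> norm (poly f x)"
    by (auto simp: eventually_at_infinity)
  have large: "1 \<le> poly f x" if "x \<in> X" "b \<le> \<bar>x\<bar>" for x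
    using b[of x] f[OF that(1)] that by simp
  show ?thesis
  proof (cases "X \<inter> cball 0 b = {}")
    case True
    then show ?thesis using that[of 1] large by (force simp: dist_norm)
  next
    case False
    have "\<exists>x0\<in>X \<inter> cball 0 b. \<forall>x\<in>X \<inter> cball 0 b. poly f x0 \<le> poly f x"
      using X False by (intro continuous_attains_inf closed_Int_compact) (auto intro!: continuous_intros)
    then obtain x0 where x0: "x0 \<in> X \<inter> cball 0 b" "\<And>x. x \<in> X \<inter> cball 0 b \<Longrightarrow> poly f x0 \<le> poly f x" by blast
    have "min 1 (poly f x0) \<le> poly f x" if "x \<in> X" for x
      using x0(2)[of x] large[OF that] that by (cases "b \<le> \<bar>x\<bar>") (auto simp: dist_norm)
    then show ?thesis using that[of "min 1 (poly f x0)"] f x0(1) by auto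
  qed
qed

text \<open>Induction on the degree: if the global minimum c >= 0 is attained at a, then f - c has a
  double root there, and \<open>f = c + (x - a)^2 h\<close> with h nonnegative of smaller
  degree.\<close>

lemma nonneg_poly_in_sos_poly:
  fixes f :: "real poly"
  assumes "\<And>x. 0 \<le> poly f x"
  shows "f \<in> sos_poly"
  using assms
proof (induction "degree f" arbitrary: f rule: less_induct)
  case less
  have sosI: "[:c:] + g\<^sup>2 * h \<in> sos_poly" if c: "0 \<le> c" and "h \<in> sos_poly" for c and g h :: "real poly"
  proof -
    obtain n k where h: "h = (\<Sum>i<(n::nat). (k i)\<^sup>2)" using \<open>h \<in> sos_poly\<close> unfolding sos_poly_def by blast
    have "[:c:] + g\<^sup>2 * h = (\<Sum>i<Suc n. ((\<lambda>i. if i < n then g * k i else [:sqrt c:]) i)\<^sup>2)"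
      using c by (simp add: h sum_distrib_left power_mult_distrib) (simp add: power2_eq_square)
    then show ?thesis unfolding sos_poly_def 
      by (intro CollectI exI[of _ "Suc n"] exI[of _ "\<lambda>i. if i < n then g * k i else [:sqrt c:]"]) simp
  qed
  have zero: "0 \<in> sos_poly" unfolding sos_poly_def by (rule CollectI, rule exI[of _ 0]) simp
  show ?case
  proof (cases "degree f = 0")
    case True
    then obtain c where c: "f = [:c:]" by (rule degree_eq_zeroE)
    then show ?thesis using less.prems[of 0] sosI[OF _ zero, of c 0] by simp
  next
    case False
    have inf: "filterlim (\<lambda>x. poly f x) at_infinity at_infinity"
      by (intro filterlim_poly_at_infinity) (use False in simp)
    \<comment> \<open>Far out the values are at least f(0) + 1, so the minimum over a large ball
      around 0 is global.\<close>
    define b0 where "b0 = poly f 0"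
    have "\<forall>\<^sub>F x in at_infinity. b0 + 1 \<le> norm (poly f x)"
      using inf less.prems[of 0] by (subst (asm) filterlim_at_infinity[where c=0]) (auto simp: b0_def add_nonneg_pos)
    then obtain b where b: "\<And>x. b \<le> norm x \<Longrightarrow> b0 + 1 \<le> norm (poly f x)"
      by (auto simp: eventually_at_infinity)
    have "\<exists>a\<in>cball 0 \<bar>b\<bar>. \<forall>x\<in>cball 0 \<bar>b\<bar>. poly f a \<le> poly f x"
      by (rule continuous_attains_inf) (auto intro!: continuous_intros)
    then obtain a where a: "\<And>x. x \<in> cball 0 \<bar>b\<bar> \<Longrightarrow> poly f a \<le> poly f x" by blast
    have "poly f a \<le> poly f x" for x
    proof (cases "\<bar>x\<bar> \<le> \<bar>b\<bar>")
      case True then show ?thesis by (intro a) simp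
    next
      case False
      then have "b0 + 1 \<le> poly f x" using b[of x] less.prems[of x] by simp
      moreover have "poly f a \<le> b0" unfolding b0_def by (intro a) simp
      ultimately show ?thesis by simp
    qed
    note min = this
    define c where "c = poly f a"
    have "poly (f - [:c:]) a = 0" by (simp add: c_def)
    then obtain g where g: "f - [:c:] = [:-a, 1:] * g" unfolding poly_eq_0_iff_dvd by (rule dvdE)
    have fg: "poly f x - c = (x - a) * poly g x" for x
      using arg_cong[OF g, of "\<lambda>p. poly p x"] by (simp add: algebra_simps)
    have "poly g a = 0"
    proof -
      have "DERIV (poly f) a :> poly (pderiv f) a" by (rule poly_DERIV)
      then have "poly (pderiv f) a = 0"
        using DERIV_local_min[of "poly f" "poly (pderiv f) a" a 1] min by simp
      moreover have "pderiv f = pderiv (f - [:c:])" by (simp add: pderiv_diff pderiv_pCons)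
      ultimately show ?thesis unfolding g by (simp add: pderiv_diff pderiv_smult pderiv_pCons)
    qed
    then obtain h where h: "g = [:-a, 1:] * h" unfolding poly_eq_0_iff_dvd by (rule dvdE)
    have fh: "poly f x - c = (x - a)\<^sup>2 * poly h x" for x
      using fg[of x] by (simp add: h power2_eq_square algebra_simps)
    have pos: "0 \<le> poly h x" if "x \<noteq> a" for x
    proof -
      have "0 \<le> (x - a)\<^sup>2 * poly h x" using fh[of x] min[of x] by (simp add: c_def)
      then show ?thesis using that by (simp add: zero_le_mult_iff)
    qed
    have "0 \<le> poly h x" for x
    proof (cases "x = a")
      case True
      have "(poly h \<longlongrightarrow> poly h a) (at a)" using poly_isCont[where p = h and x = a] by (simp add: isCont_def)
      then show ?thesis unfolding True
        by (rule tendsto_lowerbound) (auto simp: eventually_at_filter pos)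
    qed (rule pos)
    moreover have "degree h < degree f"
    proof -
      have "h \<noteq> 0" using g h False by auto
      have "degree (f - [:c:]) = degree f" 
        unfolding diff_conv_add_uminus by (rule degree_add_eq_left) (use False in simp)
      moreover have "degree (f - [:c:]) = Suc (Suc (degree h))"
        unfolding g h using \<open>h \<noteq> 0\<close> by (simp add: degree_mult_eq del: mult_pCons_left)
      ultimately show ?thesis by simp
    qed
    ultimately have "h \<in> sos_poly" by (intro less.hyps)
    moreover have "f = [:c:] + [:-a, 1:]\<^sup>2 * h"
    proof -
      have "f = [:c:] + (f - [:c:])" by simp
      then show ?thesis unfolding g h by (simp only: power2_eq_square mult.assoc)
    qed
    moreover have "0 \<le> c" using less.prems by (simp add: c_def)
    ultimately show ?thesis using sosI by metis
  qed
qed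

section \<open>Explicit multipliers for a pencil at one point\<close>

lemma pencil_ok_discriminant: "pencil_ok f t g \<Longrightarrow> 4 * f * g \<le> t\<^sup>2"
  and pencil_ok_nonpos: "pencil_ok f t g \<Longrightarrow> f \<le> 0 \<Longrightarrow> g \<le> 0 \<and> t < 0 \<and> 4 * f * g < t\<^sup>2"
proof -
  \<comment> \<open>For f <= 0 the quadratic is concave or linear, at most 0 at l = 0 and positive
    at some l >= 0. Hence its slope -t at 0 and its discriminant are positive.\<close>
  show *: "g \<le> 0 \<and> t < 0 \<and> 4 * f * g < t\<^sup>2" if ok: "pencil_ok f t g" and f: "f \<le> 0" for f
  proof -
    have g: "g \<le> 0" using ok f by (auto simp: pencil_ok_def)
    then obtain l where l: "0 \<le> l" "0 < f - t * l + g * l\<^sup>2" using ok by (auto simp: pencil_ok_def)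
    have "g * l\<^sup>2 \<le> 0" using g by (simp add: mult_nonpos_nonneg)
    then have "t * l < 0" using l f by linarith
    then have t: "t < 0" using l by (simp add: mult_less_0_iff)
    have "4 * f * g < t\<^sup>2"
    proof (cases "g = 0")
      case False
      then have "g * (f - t * l + g * l\<^sup>2) < 0" using g l by (simp add: mult_neg_pos)
      moreover have "4 * (g * (f - t * l + g * l\<^sup>2)) = (2 * g * l - t)\<^sup>2 - (t\<^sup>2 - 4 * f * g)" by algebra
      ultimately show ?thesis using zero_le_power2[of "2 * g * l - t"] by linarith
    qed (use t in simp)
    then show ?thesis using g t by simp
  qed
  show "4 * f * g \<le> t\<^sup>2" if "pencil_ok f t g"
  proof (cases "f \<le> 0")
    case False
    show ?thesis
    proof (cases "g \<le> 0")
      case True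
      then have "f * g \<le> 0" using False by (simp add: mult_nonneg_nonpos)
      then show ?thesis using zero_le_power2[of t] by linarith
    qed (use that in \<open>auto simp: pencil_ok_def\<close>)
  qed (use *[OF that] in simp)
qed

text \<open>Homogeneous form of the choice l = p / q, so that q and p can be values of polynomials.
  For g > 0 the last condition keeps l left of the vertex t / (2 g), as in
  \<open>pencil_pd\<close>.\<close>

definition multiplier_ok :: "real \<Rightarrow> real \<Rightarrow> real \<Rightarrow> real \<Rightarrow> real \<Rightarrow> bool" where
  "multiplier_ok f t g q p \<longleftrightarrow> 0 < q \<and> 0 \<le> p \<and> 0 < f * q\<^sup>2 - t * q * p + g * p\<^sup>2 \<and>
     (g \<le> 0 \<or> 2 * g * p < t * q)"

lemma multiplier_ok_one: "pencil_ok f t g \<Longrightarrow> 0 < f \<Longrightarrow> multiplier_ok f t g 1 0"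
  by (auto simp: multiplier_ok_def pencil_ok_def)

text \<open>Here p / q = t / (2 g), where the concave quadratic is largest.\<close>

lemma multiplier_ok_vertex:
  assumes "g < 0" "t < 0" "4 * f * g < t\<^sup>2"
  shows "multiplier_ok f t g (4 * g\<^sup>2) (2 * g * t)"
proof -
  have "f * (4 * g\<^sup>2)\<^sup>2 - t * (4 * g\<^sup>2) * (2 * g * t) + g * (2 * g * t)\<^sup>2 = (- g) ^ 3 * 4 * (t\<^sup>2 - 4 * f * g)"
    by algebra
  moreover have "0 < (- g) ^ 3 * 4 * (t\<^sup>2 - 4 * f * g)"
    using assms by (intro mult_pos_pos zero_less_power) auto
  ultimately show ?thesis using assms by (simp add: multiplier_ok_def mult_neg_neg less_imp_le)
qed

text \<open>Here \<open>l = - (1 + f^2) / t\<close>, so that f - t l = 1 + f + f^2 > 0.\<close>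

lemma multiplier_ok_linear:
  assumes "t < 0"
  shows "multiplier_ok f t 0 (t\<^sup>2) (- t * (1 + f\<^sup>2))"
proof -
  have "f * (t\<^sup>2)\<^sup>2 - t * t\<^sup>2 * (- t * (1 + f\<^sup>2)) = t ^ 4 * ((f + 1/2)\<^sup>2 + 3/4)" by algebra
  moreover have "0 < t ^ 4 * ((f + 1/2)\<^sup>2 + 3/4)" using assms by (simp add: add_nonneg_pos)
  moreover have "0 \<le> - t * (1 + f\<^sup>2)" using assms by (intro mult_nonneg_nonneg) auto
  ultimately show ?thesis using assms by (simp add: multiplier_ok_def)
qed

text \<open>With \<open>q = (s t + r)\<^sup>2\<close> and \<open>p = 2 s f (s t + r)\<close>, the quotient \<open>p / q\<close> is the root
  \<open>2 f / (t + sqrt D)\<close> of \<open>f - t l + g l\<^sup>2\<close> with the square root of the discriminant \<open>D\<close> replaced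
  by \<open>r / s\<close>; an overestimate of \<open>sqrt D\<close> moves \<open>l\<close> below that root, an underestimate above it.\<close>

lemma multiplier_root_identity:
  fixes f t g s r :: real
  defines "w \<equiv> s * t + r"
  shows "f * (w\<^sup>2)\<^sup>2 - t * w\<^sup>2 * (2 * s * f * w) + g * (2 * s * f * w)\<^sup>2
    = w\<^sup>2 * (f * (r\<^sup>2 - s\<^sup>2 * (t\<^sup>2 - 4 * f * g)))"
  unfolding w_def by algebra

text \<open>After cancelling \<open>w = s t + r\<close> the side condition reads 4 g s f < t w; it
  follows from 4 f g <= t^2 and w > s t.\<close>

lemma multiplier_ok_above_root:
  assumes "f > 0" "t > 0" "s > 0" "r > 0" "s\<^sup>2 * (t\<^sup>2 - 4 * f * g) < r\<^sup>2" "4 * f * g \<le> t\<^sup>2"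
  shows "multiplier_ok f t g ((s * t + r)\<^sup>2) (2 * s * f * (s * t + r))"
proof -
  define w where "w = s * t + r"
  have w: "0 < w" using assms by (simp add: w_def add_pos_pos)
  have "0 < w\<^sup>2 * (f * (r\<^sup>2 - s\<^sup>2 * (t\<^sup>2 - 4 * f * g)))" using assms w by simp
  moreover have "2 * g * (2 * s * f * w) < t * w\<^sup>2"
  proof -
    have "s * (4 * f * g) \<le> s * t\<^sup>2" using assms by (intro mult_left_mono) auto
    also have "\<dots> < t * w" using assms by (simp add: w_def power2_eq_square algebra_simps)
    finally have "w * (s * (4 * f * g)) < w * (t * w)" using w by simp
    then show ?thesis by (simp add: power2_eq_square algebra_simps)
  qed
  ultimately show ?thesis
    using assms w unfolding multiplier_ok_def w_def[symmetric]
      multiplier_root_identity[of f s t r g, folded w_def] by simp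
qed

text \<open>Since f g >= 0, the bound on r gives |r| < s |t|. Hence \<open>w = s t + r\<close> is
  negative and p = 2 s f w is nonnegative.\<close>

lemma multiplier_ok_below_root:
  assumes "f < 0" "t < 0" "g \<le> 0" "s > 0" "r\<^sup>2 < s\<^sup>2 * (t\<^sup>2 - 4 * f * g)"
  shows "multiplier_ok f t g ((s * t + r)\<^sup>2) (2 * s * f * (s * t + r))"
proof -
  define w where "w = s * t + r"
  have "0 \<le> f * g" using assms by (simp add: mult_nonpos_nonpos)
  then have "s\<^sup>2 * (t\<^sup>2 - 4 * f * g) \<le> s\<^sup>2 * t\<^sup>2" by (intro mult_left_mono) auto
  then have "r\<^sup>2 < (s * t)\<^sup>2" using assms(5) unfolding power_mult_distrib by linarith
  then have "\<bar>r\<bar> < \<bar>s * t\<bar>" using abs_le_square_iff not_le by blast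
  moreover have "s * t < 0" using assms by (simp add: mult_pos_neg)
  ultimately have w: "w < 0" by (simp add: w_def)
  have "0 < w\<^sup>2 * (f * (r\<^sup>2 - s\<^sup>2 * (t\<^sup>2 - 4 * f * g)))" using assms w by (intro mult_pos_pos mult_neg_neg) auto
  moreover have "0 \<le> 2 * s * f * w" using assms w by (simp add: mult_nonpos_nonpos mult_nonneg_nonpos)
  ultimately show ?thesis
    using assms w unfolding multiplier_ok_def w_def[symmetric]
      multiplier_root_identity[of f s t r g, folded w_def] by simp
qed

text \<open>The signs of E at the two ends make its degree even. A two-term approximation r of its
  square root can be chosen so that r^2 - E has odd degree and therefore opposite signs at the two
  ends.\<close>

lemma approximate_sqrt_poly:
  fixes E :: "real poly"
  assumes top: "\<forall>\<^sub>F x in at_top. 0 < poly E x" and bot: "\<forall>\<^sub>F x in at_bot. 0 < poly E x"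
    and deg: "degree E \<noteq> 0"
  obtains r where "\<forall>\<^sub>F x in at_top. 0 < poly r x \<and> poly E x < (poly r x)\<^sup>2"
    "\<forall>\<^sub>F x in at_bot. (poly r x)\<^sup>2 < poly E x"
proof -
  define d where "d = lead_coeff E"
  have d: "0 < d" using top by (simp add: poly_pos_at_top_iff d_def)
  have "0 < (-1) ^ degree E * d" using bot by (simp add: poly_pos_at_bot_iff d_def)
  then have "even (degree E)" using d by (cases "even (degree E)") auto
  then obtain k' where "degree E = 2 * k'" by (elim evenE)
  then obtain k where k: "degree E = 2 * k + 2" using deg by (cases k') auto
  \<comment> \<open>The coefficient of r^2 in degree 2 k + 1 is 2 d C. This choice makes it exceed
    that of E by 1, so r^2 - E has leading term x^(2k+1).\<close>
  define C where "C = (coeff E (2 * k + 1) + 1) / (2 * d)"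
  define r where "r = smult (sqrt d) (monom 1 (Suc k) + monom C k)"
  have r2: "r\<^sup>2 = monom d (2 * k + 2) + monom (2 * d * C) (2 * k + 1) + monom (d * C\<^sup>2) (2 * k)"
  proof -
    have "r\<^sup>2 = smult d ((monom 1 (Suc k) + monom C k)\<^sup>2)"
      using d by (simp add: r_def smult_power)
    also have "(monom 1 (Suc k) + monom C k)\<^sup>2 = monom 1 (2 * k + 2) + monom (2 * C) (2 * k + 1) + monom (C\<^sup>2) (2 * k)"
    proof -
      have sq: "(u + v)\<^sup>2 = u * u + (u * v + u * v) + v * v" for u v :: "real poly" by algebra
      have idx: "Suc k + Suc k = 2 * k + 2" "Suc k + k = 2 * k + 1" "k + k = 2 * k" by simp_all
      show ?thesis
        unfolding sq mult_monom add_monom idx by (simp add: power2_eq_square[of C])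
    qed
    finally show ?thesis by (simp add: smult_add_right smult_monom)
  qed
  define P where "P = r\<^sup>2 - E"
  have c: "coeff P (2 * k + 1) = 1" using d by (simp add: P_def r2 C_def)
  have "coeff P i = 0" if "i > 2 * k + 1" for i
  proof (cases "i = 2 * k + 2")
    case True then show ?thesis by (simp add: P_def r2 d_def k)
  next
    case False
    then have "coeff E i = 0" using that k by (intro coeff_eq_0) simp
    then show ?thesis using that False by (simp add: P_def r2)
  qed
  then have "degree P \<le> 2 * k + 1" by (simp add: degree_le)
  moreover have "2 * k + 1 \<le> degree P" using c by (intro le_degree) simp
  ultimately have degP: "degree P = 2 * k + 1" by simp
  have top: "\<forall>\<^sub>F x in at_top. 0 < poly P x" using c degP by (simp add: poly_pos_at_top_iff)
  have bot: "\<forall>\<^sub>F x in at_bot. 0 < poly (- P) x"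
    unfolding poly_pos_at_bot_iff using c degP by simp
  have r: "\<forall>\<^sub>F x in at_top. 0 < poly r x"
  proof -
    have "degree (monom 1 (Suc k) + monom C k) = Suc k"
      by (subst degree_add_eq_left) (auto simp: degree_monom_eq intro: le_less_trans[OF degree_monom_le])
    then show ?thesis unfolding poly_pos_at_top_iff r_def using d by simp
  qed
  show ?thesis
  proof
    show "\<forall>\<^sub>F x in at_top. 0 < poly r x \<and> poly E x < (poly r x)\<^sup>2"
      using top r by eventually_elim (simp add: P_def poly_power)
    show "\<forall>\<^sub>F x in at_bot. (poly r x)\<^sup>2 < poly E x"
      using bot by eventually_elim (simp add: P_def poly_power)
  qed
qed

subsection \<open>Multipliers near infinity\<close>

text \<open>Near -infinity, f <= 0 forces t < 0. If near +infinity points of K also have t < 0, the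
  vertex works at both ends, or the linear choice if g = 0. Otherwise f and t are positive near
  +infinity, and the approximate root of the discriminant is used.\<close>

lemma multiplier_at_ends_if_nonpos_at_bot:
  fixes f t g :: "real poly"
  assumes ok: "\<And>x. x \<in> K \<Longrightarrow> pencil_ok (poly f x) (poly t x) (poly g x)"
    and bot: "\<forall>\<^sub>F x in at_bot. x \<in> K \<and> poly f x \<le> 0"
    and top: "(\<forall>\<^sub>F x in at_top. x \<in> K) \<or> (\<forall>\<^sub>F x in at_top. x \<notin> K)"
  shows "\<exists>q p. (\<forall>\<^sub>F x in at_top. x \<in> K \<longrightarrow> multiplier_ok (poly f x) (poly t x) (poly g x) (poly q x) (poly p x)) \<and>
    (\<forall>\<^sub>F x in at_bot. x \<in> K \<longrightarrow> multiplier_ok (poly f x) (poly t x) (poly g x) (poly q x) (poly p x))"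
    (is "\<exists>q p. eventually (?ok q p) at_top \<and> eventually (?ok q p) at_bot")
proof -
  have neg: "\<forall>\<^sub>F x in at_bot. poly g x \<le> 0 \<and> poly t x < 0 \<and> 4 * poly f x * poly g x < (poly t x)\<^sup>2"
    using bot by eventually_elim (use ok pencil_ok_nonpos in blast)
  have "\<exists>x. poly t x < 0"
    using eventually_happens'[OF _ neg] by auto
  then have t0: "t \<noteq> 0" by auto
  have "(\<forall>\<^sub>F x in at_top. x \<in> K \<and> 0 < poly t x) \<or> (\<forall>\<^sub>F x in at_top. \<not> (x \<in> K \<and> 0 < poly t x))"
    using top poly_pos_decided by (intro eventually_decided_conj) auto
  then consider (a) "\<forall>\<^sub>F x in at_top. x \<notin> K \<or> poly t x < 0"
    | (b) "\<forall>\<^sub>F x in at_top. x \<in> K \<and> 0 < poly t x"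
  proof (elim disjE)
    assume "\<forall>\<^sub>F x in at_top. \<not> (x \<in> K \<and> 0 < poly t x)"
    moreover have "\<forall>\<^sub>F x in at_top. poly t x \<noteq> 0" by (rule poly_eventually_nonzero[OF t0]) simp
    ultimately have "\<forall>\<^sub>F x in at_top. x \<notin> K \<or> poly t x < 0" by eventually_elim auto
    then show ?thesis by (rule a)
  qed (rule b)
  then show ?thesis
  proof cases
    case a
    show ?thesis
    proof (cases "g = 0")
      case True
      have *: "?ok (t\<^sup>2) (- t * (1 + f\<^sup>2)) x" if "x \<notin> K \<or> poly t x < 0" for x
        using multiplier_ok_linear[of "poly t x" "poly f x"] that True by auto
      have "eventually (?ok (t\<^sup>2) (- t * (1 + f\<^sup>2))) at_top"
        using a by (rule eventually_mono) (rule *)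
      moreover have "eventually (?ok (t\<^sup>2) (- t * (1 + f\<^sup>2))) at_bot"
        using neg by (rule eventually_mono) (use * in blast)
      ultimately show ?thesis by blast
    next
      case False
      have *: "?ok (4 * g\<^sup>2) (2 * g * t) x" if "x \<notin> K \<or> poly t x < 0 \<and> poly g x < 0 \<and> 4 * poly f x * poly g x < (poly t x)\<^sup>2" for x
        using multiplier_ok_vertex[of "poly g x" "poly t x" "poly f x"] that by auto
      have "\<forall>\<^sub>F x in at_top. poly g x \<noteq> 0" by (rule poly_eventually_nonzero[OF False]) simp
      with a have "\<forall>\<^sub>F x in at_top. ?ok (4 * g\<^sup>2) (2 * g * t) x"
      proof eventually_elim
        case (elim x)
        show ?case
        proof (cases "x \<in> K")
          case True
          then have t: "poly t x < 0" and o: "pencil_ok (poly f x) (poly t x) (poly g x)" using elim ok by auto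
          then have g: "poly g x < 0" using elim by (auto simp: pencil_ok_def)
          have "4 * poly f x * poly g x < (poly t x)\<^sup>2"
          proof (cases "poly f x \<le> 0")
            case True then show ?thesis using pencil_ok_nonpos[OF o] by blast
          next
            case False
            then have "poly f x * poly g x < 0" using g by (simp add: mult_pos_neg)
            moreover have "0 < (poly t x)\<^sup>2" using t by simp
            ultimately show ?thesis by linarith
          qed
          then show ?thesis using * t g by blast
        qed simp
      qed
      moreover have "\<forall>\<^sub>F x in at_bot. poly g x \<noteq> 0" by (rule poly_eventually_nonzero[OF False]) simp
      with neg have "\<forall>\<^sub>F x in at_bot. ?ok (4 * g\<^sup>2) (2 * g * t) x"
        by eventually_elim (intro *, simp add: less_le)
      ultimately show ?thesis by blast
    qed
  next
    case b
    have f_top: "\<forall>\<^sub>F x in at_top. 0 < poly f x"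
      using b by eventually_elim (use ok pencil_ok_nonpos in \<open>fastforce simp: not_less[symmetric]\<close>)
    then have "f \<noteq> 0" using eventually_happens'[OF _ f_top] by auto
    then have "\<forall>\<^sub>F x in at_bot. poly f x \<noteq> 0" by (rule poly_eventually_nonzero) simp
    then have f_bot: "\<forall>\<^sub>F x in at_bot. poly f x < 0"
      using bot by eventually_elim auto
    define D where "D = t\<^sup>2 - 4 * f * g"
    have D: "poly D x = (poly t x)\<^sup>2 - 4 * poly f x * poly g x" for x by (simp add: D_def)
    have D_bot: "\<forall>\<^sub>F x in at_bot. 0 < poly D x" using neg by eventually_elim (simp add: D)
    then have "D \<noteq> 0" using eventually_happens'[OF _ D_bot] by auto
    then have "\<forall>\<^sub>F x in at_top. poly D x \<noteq> 0" by (rule poly_eventually_nonzero) simp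
    then have D_top: "\<forall>\<^sub>F x in at_top. 0 < poly D x"
      using b by eventually_elim (use ok pencil_ok_discriminant in \<open>fastforce simp: D less_le\<close>)
    \<comment> \<open>\<open>s\<close> is positive at both ends, and \<open>s^2 D\<close> has
      positive degree even if D is constant, as \<open>approximate_sqrt_poly\<close>
      requires.\<close>
    define s :: "real poly" where "s = [:0, 1:]\<^sup>2"
    define E where "E = s\<^sup>2 * D"
    have s: "0 < poly s x" if "x \<noteq> 0" for x using that by (simp add: s_def)
    have E: "poly E x = (poly s x)\<^sup>2 * ((poly t x)\<^sup>2 - 4 * poly f x * poly g x)" for x by (simp add: E_def D)
    have nz: "\<forall>\<^sub>F x in at_top. x \<noteq> (0::real)" "\<forall>\<^sub>F x in at_bot. x \<noteq> (0::real)"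
      using eventually_gt_at_top[of 0] eventually_gt_at_bot[of 0] by (auto elim: eventually_mono)
    have "\<forall>\<^sub>F x in at_top. 0 < poly E x"
      using D_top nz(1) by eventually_elim (use s in \<open>fastforce simp: E D\<close>)
    moreover have "\<forall>\<^sub>F x in at_bot. 0 < poly E x"
      using D_bot nz(2) by eventually_elim (use s in \<open>fastforce simp: E D\<close>)
    moreover have "degree E \<noteq> 0"
    proof -
      have "degree s = 2" "s \<noteq> 0" by (auto simp: s_def degree_power_eq)
      then show ?thesis using \<open>D \<noteq> 0\<close> by (simp add: E_def degree_mult_eq degree_power_eq)
    qed
    ultimately obtain r where r_top: "\<forall>\<^sub>F x in at_top. 0 < poly r x \<and> poly E x < (poly r x)\<^sup>2"
      and r_bot: "\<forall>\<^sub>F x in at_bot. (poly r x)\<^sup>2 < poly E x"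
      by (rule approximate_sqrt_poly)
    define q where "q = (s * t + r)\<^sup>2"
    define p where "p = 2 * s * f * (s * t + r)"
    have qp: "poly q x = (poly s x * poly t x + poly r x)\<^sup>2"
      "poly p x = 2 * poly s x * poly f x * (poly s x * poly t x + poly r x)" for x
      by (simp_all add: q_def p_def)
    have "\<forall>\<^sub>F x in at_top. ?ok q p x"
      using f_top b r_top nz(1)
      by eventually_elim (use ok pencil_ok_discriminant s in \<open>simp add: qp E multiplier_ok_above_root\<close>)
    moreover have "\<forall>\<^sub>F x in at_bot. ?ok q p x"
      using f_bot neg r_bot nz(2) by eventually_elim (simp add: qp E multiplier_ok_below_root s)
    ultimately show ?thesis by blast
  qed
qed

text \<open>If f > 0 on K near both ends, l = 0 works. Otherwise f <= 0 near one end, which the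
  reflection x -> -x can move to -infinity.\<close>

lemma multiplier_at_ends:
  fixes f t g :: "real poly"
  assumes ok: "\<And>x. x \<in> K \<Longrightarrow> pencil_ok (poly f x) (poly t x) (poly g x)"
    and top: "(\<forall>\<^sub>F x in at_top. x \<in> K) \<or> (\<forall>\<^sub>F x in at_top. x \<notin> K)"
    and bot: "(\<forall>\<^sub>F x in at_bot. x \<in> K) \<or> (\<forall>\<^sub>F x in at_bot. x \<notin> K)"
  shows "\<exists>q p. (\<forall>\<^sub>F x in at_top. x \<in> K \<longrightarrow> multiplier_ok (poly f x) (poly t x) (poly g x) (poly q x) (poly p x)) \<and>
    (\<forall>\<^sub>F x in at_bot. x \<in> K \<longrightarrow> multiplier_ok (poly f x) (poly t x) (poly g x) (poly q x) (poly p x))"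
    (is "\<exists>q p. eventually (?ok q p) at_top \<and> eventually (?ok q p) at_bot")
proof -
  have dec_top: "(\<forall>\<^sub>F x in at_top. x \<in> K \<longrightarrow> 0 < poly f x) \<or> (\<forall>\<^sub>F x in at_top. x \<in> K \<and> poly f x \<le> 0)"
  proof -
    have "(\<forall>\<^sub>F x in at_top. x \<in> K \<and> \<not> 0 < poly f x) \<or> (\<forall>\<^sub>F x in at_top. \<not> (x \<in> K \<and> \<not> 0 < poly f x))"
      using top poly_pos_decided[of at_top f] by (intro eventually_decided_conj) auto
    then show ?thesis by (simp add: not_less not_le disj_commute)
  qed
  have dec_bot: "(\<forall>\<^sub>F x in at_bot. x \<in> K \<longrightarrow> 0 < poly f x) \<or> (\<forall>\<^sub>F x in at_bot. x \<in> K \<and> poly f x \<le> 0)"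
  proof -
    have "(\<forall>\<^sub>F x in at_bot. x \<in> K \<and> \<not> 0 < poly f x) \<or> (\<forall>\<^sub>F x in at_bot. \<not> (x \<in> K \<and> \<not> 0 < poly f x))"
      using bot poly_pos_decided[of at_bot f] by (intro eventually_decided_conj) auto
    then show ?thesis by (simp add: not_less not_le disj_commute)
  qed
  consider (pos) "\<forall>\<^sub>F x in at_top. x \<in> K \<longrightarrow> 0 < poly f x" "\<forall>\<^sub>F x in at_bot. x \<in> K \<longrightarrow> 0 < poly f x"
    | (bot) "\<forall>\<^sub>F x in at_bot. x \<in> K \<and> poly f x \<le> 0"
    | (top) "\<forall>\<^sub>F x in at_top. x \<in> K \<and> poly f x \<le> 0"
    using dec_top dec_bot by blast
  then show ?thesis
  proof cases
    case pos
    have "eventually (?ok 1 0) at_top" "eventually (?ok 1 0) at_bot"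
      using pos by (auto elim!: eventually_mono simp: ok multiplier_ok_one)
    then show ?thesis by blast
  next
    case bot
    show ?thesis by (rule multiplier_at_ends_if_nonpos_at_bot[OF ok bot top])
  next
    case top
    define K' where "K' = {x. - x \<in> K}"
    have "\<exists>q p. (\<forall>\<^sub>F x in at_top. x \<in> K' \<longrightarrow> multiplier_ok (poly (refl_poly f) x) (poly (refl_poly t) x)
        (poly (refl_poly g) x) (poly q x) (poly p x)) \<and>
      (\<forall>\<^sub>F x in at_bot. x \<in> K' \<longrightarrow> multiplier_ok (poly (refl_poly f) x) (poly (refl_poly t) x)
        (poly (refl_poly g) x) (poly q x) (poly p x))"
    proof (rule multiplier_at_ends_if_nonpos_at_bot)
      show "pencil_ok (poly (refl_poly f) x) (poly (refl_poly t) x) (poly (refl_poly g) x)" if "x \<in> K'" for x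
        using ok[of "- x"] that by (simp add: poly_refl_poly K'_def)
      show "\<forall>\<^sub>F x in at_bot. x \<in> K' \<and> poly (refl_poly f) x \<le> 0"
        using top by (simp add: eventually_at_bot_uminus poly_refl_poly K'_def)
      show "(\<forall>\<^sub>F x in at_top. x \<in> K') \<or> (\<forall>\<^sub>F x in at_top. x \<notin> K')"
        using bot by (simp add: eventually_at_bot_uminus K'_def)
    qed
    then obtain q p where qp:
      "\<forall>\<^sub>F x in at_top. - x \<in> K \<longrightarrow> multiplier_ok (poly f (- x)) (poly t (- x)) (poly g (- x)) (poly q x) (poly p x)"
      "\<forall>\<^sub>F x in at_top. x \<in> K \<longrightarrow> multiplier_ok (poly f x) (poly t x) (poly g x) (poly q (- x)) (poly p (- x))"
      by (auto simp: eventually_at_bot_uminus poly_refl_poly K'_def)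
    show ?thesis
      by (intro exI[of _ "refl_poly q"] exI[of _ "refl_poly p"])
        (use qp in \<open>simp add: eventually_at_bot_uminus poly_refl_poly\<close>)
  qed
qed

subsection \<open>A global multiplier\<close>

text \<open>Trace and determinant have positive lower bounds on X, so by
  \<open>qf_lower_bound\<close> a suitable multiple of the form dominates P times the squared
  length.\<close>

lemma exists_pd_scaling:
  fixes A B C P :: "real poly"
  assumes X: "closed X" and pd: "\<And>x. x \<in> X \<Longrightarrow> pd (poly A x) (poly B x) (poly C x)"
  obtains h where "\<And>x. 0 \<le> poly h x" "\<And>x. x \<in> X \<Longrightarrow> poly P x \<le> poly h x"
    "\<And>x y z. x \<in> X \<Longrightarrow> poly P x * (y\<^sup>2 + z\<^sup>2) \<le> poly h x * qf (poly A x) (poly B x) (poly C x) y z"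
proof -
  have "0 < poly (A + C) x" "0 < poly (A * C - B\<^sup>2) x" if "x \<in> X" for x
    using pd_pos[OF pd[OF that]] by simp_all
  then obtain d e where d: "0 < d" "\<And>x. x \<in> X \<Longrightarrow> d \<le> poly (A + C) x"
    and e: "0 < e" "\<And>x. x \<in> X \<Longrightarrow> e \<le> poly (A * C - B\<^sup>2) x"
    using poly_pos_closed_lower_bound[OF X] by metis
  define m where "m = 1 / d\<^sup>2 + 1 / (d * e)"
  have m: "1 \<le> m * (d * d)" "1 \<le> m * (d * e)" "0 < m"
    using d(1) e(1) by (auto simp: m_def field_simps power2_eq_square)
  \<comment> \<open>One factor A + C is consumed by \<open>qf_lower_bound\<close>; the second makes
    h nonnegative on the whole line.\<close>
  define h where "h = smult m ((A + C)\<^sup>2 * (1 + P\<^sup>2))"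
  have h: "poly h x = m * (poly A x + poly C x)\<^sup>2 * (1 + (poly P x)\<^sup>2)" for x by (simp add: h_def)
  have P: "poly P x \<le> 1 + (poly P x)\<^sup>2" for x
    using abs_le_one_plus_square[of "poly P x"] by linarith
  show ?thesis
  proof
    show "0 \<le> poly h x" for x unfolding h using m(3) by simp
    fix x assume x: "x \<in> X"
    let ?t = "poly A x + poly C x" and ?d = "poly A x * poly C x - (poly B x)\<^sup>2"
    have t: "d \<le> ?t" and D: "e \<le> ?d" using d(2)[OF x] e(2)[OF x] by simp_all
    have "1 \<le> m * (?t * ?t)"
      using m(1) mult_mono[OF t t] d(1) t mult_left_mono[of "d * d" "?t * ?t" m] m(3) by linarith
    then have "1 * (1 + (poly P x)\<^sup>2) \<le> m * ?t\<^sup>2 * (1 + (poly P x)\<^sup>2)"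
      by (intro mult_right_mono) (auto simp: power2_eq_square mult.assoc)
    then show "poly P x \<le> poly h x" unfolding h using order_trans[OF P[of x]] by simp
    show "poly P x * (y\<^sup>2 + z\<^sup>2) \<le> poly h x * qf (poly A x) (poly B x) (poly C x) y z" for y z
    proof -
      have "1 \<le> m * (?t * ?d)"
        using m(2) mult_mono[OF t D] d(1) e(1) t mult_left_mono[of "d * e" "?t * ?d" m] m(3) by linarith
      then have "1 * ((1 + (poly P x)\<^sup>2) * (y\<^sup>2 + z\<^sup>2)) \<le> m * (?t * ?d) * ((1 + (poly P x)\<^sup>2) * (y\<^sup>2 + z\<^sup>2))"
        by (intro mult_right_mono) auto
      moreover have "poly P x * (y\<^sup>2 + z\<^sup>2) \<le> (1 + (poly P x)\<^sup>2) * (y\<^sup>2 + z\<^sup>2)"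
        using P by (intro mult_right_mono) auto
      moreover have "(m * ?t * (1 + (poly P x)\<^sup>2)) * (?d * (y\<^sup>2 + z\<^sup>2))
          \<le> (m * ?t * (1 + (poly P x)\<^sup>2)) * (?t * qf (poly A x) (poly B x) (poly C x) y z)"
        using qf_lower_bound[OF pd[OF x]] m(3) t d(1) by (intro mult_left_mono) auto
      ultimately show ?thesis unfolding h by (simp add: power2_eq_square mult_ac)
    qed
  qed
qed

section \<open>Polynomial pairs that make the pencil positive definite on \<open>K\<close>\<close>

locale positive_pencil =
  fixes F1 F2 F3 G1 G2 G3 :: "real poly"
  assumes B1: "\<And>a x y. x \<noteq> 0 \<or> y \<noteq> 0 \<Longrightarrow> 0 \<le> qf (poly G1 a) (poly G2 a) (poly G3 a) x y \<Longrightarrow>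
    0 < qf (poly F1 a) (poly F2 a) (poly F3 a) x y"
begin

definition form :: "real poly \<Rightarrow> real poly \<Rightarrow> real \<Rightarrow> real \<Rightarrow> real \<Rightarrow> real" where
  "form q p a = qf (poly (q * F1 - p * G1) a) (poly (q * F2 - p * G2) a) (poly (q * F3 - p * G3) a)"

text \<open>Strict positivity of p makes this an open condition. On \<open>K\<close> it implies q >
  0, see \<open>good_imp_pos\<close>.\<close>

definition good :: "real poly \<Rightarrow> real poly \<Rightarrow> real \<Rightarrow> bool" where
  "good q p a \<longleftrightarrow> 0 < poly p a \<and>
    pd (poly (q * F1 - p * G1) a) (poly (q * F2 - p * G2) a) (poly (q * F3 - p * G3) a)"

definition K :: "real set" where
  "K = {a. 0 \<le> poly G1 a \<or> poly (G1 * G3 - G2\<^sup>2) a \<le> 0}"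

lemma form_eq:
  "form q p a x y = poly q a * qf (poly F1 a) (poly F2 a) (poly F3 a) x y
    - poly p a * qf (poly G1 a) (poly G2 a) (poly G3 a) x y"
  by (simp add: form_def qf_def algebra_simps)

lemma good_iff: "good q p a \<longleftrightarrow> 0 < poly p a \<and> (\<forall>x y. x \<noteq> 0 \<or> y \<noteq> 0 \<longrightarrow> 0 < form q p a x y)"
  unfolding good_def form_def pd_iff ..

lemma closed_K: "closed K"
proof -
  have "K = {a. 0 \<le> poly G1 a} \<union> {a. poly (G1 * G3 - G2\<^sup>2) a \<le> 0}" by (auto simp: K_def)
  then show ?thesis by (simp only:) (intro closed_Un closed_Collect_le continuous_intros)
qed

lemma open_good: "open {a. good q p a}"
proof -
  have "{a. good q p a} = {a. 0 < poly p a} \<inter> ({a. 0 < poly (q * F1 - p * G1) a} \<inter>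
      {a. 0 < poly (q * F1 - p * G1) a * poly (q * F3 - p * G3) a - (poly (q * F2 - p * G2) a)\<^sup>2})"
    by (auto simp: good_def pd_def)
  then show ?thesis by (simp only:) (intro open_Int open_Collect_less continuous_intros)
qed

lemma K_decided:
  assumes "F = at_top \<or> F = at_bot"
  shows "(\<forall>\<^sub>F x in F. x \<in> K) \<or> (\<forall>\<^sub>F x in F. x \<notin> K)"
proof -
  have "x \<in> K \<longleftrightarrow> \<not> (0 < poly (- G1) x \<and> 0 < poly (G1 * G3 - G2\<^sup>2) x)" for x
    by (auto simp: K_def)
  moreover have "(\<forall>\<^sub>F x in F. 0 < poly (- G1) x \<and> 0 < poly (G1 * G3 - G2\<^sup>2) x) \<or>
      (\<forall>\<^sub>F x in F. \<not> (0 < poly (- G1) x \<and> 0 < poly (G1 * G3 - G2\<^sup>2) x))"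
    by (intro eventually_decided_conj poly_pos_decided assms)
  ultimately show ?thesis by (simp only: not_not disj_commute)
qed

abbreviation "fdet \<equiv> F1 * F3 - F2\<^sup>2"
abbreviation "gdet \<equiv> G1 * G3 - G2\<^sup>2"
abbreviation "mdet \<equiv> F1 * G3 + F3 * G1 - 2 * F2 * G2"

lemma pencil_ok_K: "a \<in> K \<Longrightarrow> pencil_ok (poly fdet a) (poly mdet a) (poly gdet a)"
  using pencil_ok_if_positive[of "poly G1 a" "poly G2 a" "poly G3 a" "poly F1 a" "poly F2 a" "poly F3 a", OF B1]
  by (simp add: K_def)

lemma pd_if_multiplier_ok:
  assumes "a \<in> K" "multiplier_ok (poly fdet a) (poly mdet a) (poly gdet a) q p"
  shows "pd (q * poly F1 a - p * poly G1 a) (q * poly F2 a - p * poly G2 a) (q * poly F3 a - p * poly G3 a)"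
  using assms by (intro pencil_pd B1) (auto simp: K_def multiplier_ok_def)

text \<open>Multiplying q and p by the same nonnegative h multiplies the form by h, so p and the
  form can be made to dominate P simultaneously.\<close>

lemma good_scaling:
  assumes X: "closed X" and good: "\<And>x. x \<in> X \<Longrightarrow> good q p x"
  obtains q' p' where "\<And>x. x \<in> X \<Longrightarrow> poly P x \<le> poly p' x"
    "\<And>x y z. x \<in> X \<Longrightarrow> poly P x * (y\<^sup>2 + z\<^sup>2) \<le> form q' p' x y z"
proof -
  obtain d where d: "0 < d" "\<And>x. x \<in> X \<Longrightarrow> d \<le> poly p x"
    using poly_pos_closed_lower_bound[OF X, of p] good good_def by metis
  obtain h where h: "\<And>x. 0 \<le> poly h x" "\<And>x. x \<in> X \<Longrightarrow> poly (smult (1 + 1 / d) (1 + P\<^sup>2)) x \<le> poly h x"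
    "\<And>x y z. x \<in> X \<Longrightarrow> poly (smult (1 + 1 / d) (1 + P\<^sup>2)) x * (y\<^sup>2 + z\<^sup>2) \<le> poly h x * form q p x y z"
    using exists_pd_scaling[OF X, of "q * F1 - p * G1" "q * F2 - p * G2" "q * F3 - p * G3"]
      good unfolding good_def form_def by metis
  have P: "poly P x \<le> 1 + (poly P x)\<^sup>2" for x
    using abs_le_one_plus_square[of "poly P x"] by linarith
  show ?thesis
  proof (rule that[of "h * p" "h * q"])
    fix x assume x: "x \<in> X"
    have "(1 + 1 / d) * (1 + (poly P x)\<^sup>2) * d \<le> poly h x * poly p x"
      using h(1)[of x] h(2)[OF x] d(1) d(2)[OF x] by (intro mult_mono) auto
    moreover have "(1 + 1 / d) * (1 + (poly P x)\<^sup>2) * d = (1 + d) * (1 + (poly P x)\<^sup>2)"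
      using d(1) by (simp add: field_simps)
    moreover have "1 * (1 + (poly P x)\<^sup>2) \<le> (1 + d) * (1 + (poly P x)\<^sup>2)"
      using d(1) by (intro mult_right_mono) auto
    ultimately show "poly P x \<le> poly (h * p) x" using P[of x] by simp
    fix y z
    have "1 * (1 + (poly P x)\<^sup>2) \<le> (1 + 1 / d) * (1 + (poly P x)\<^sup>2)"
      using d(1) by (intro mult_right_mono) auto
    then have "poly P x \<le> (1 + 1 / d) * (1 + (poly P x)\<^sup>2)" using order_trans[OF P[of x]] by simp
    then have "poly P x * (y\<^sup>2 + z\<^sup>2) \<le> (1 + 1 / d) * (1 + (poly P x)\<^sup>2) * (y\<^sup>2 + z\<^sup>2)"
      by (rule mult_right_mono) simp
    also have "\<dots> \<le> poly h x * form q p x y z" using h(3)[OF x, of y z] by simp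
    also have "\<dots> = form (h * q) (h * p) x y z" by (simp add: form_eq algebra_simps)
    finally show "poly P x * (y\<^sup>2 + z\<^sup>2) \<le> form (h * q) (h * p) x y z" .
  qed
qed

text \<open>A polynomial majorant of |p| and of the form on unit vectors. The constant is one more
  than the 3 of \<open>qf_bound\<close>, which makes the estimate of the form strict.\<close>

definition bound :: "real poly \<Rightarrow> real poly \<Rightarrow> real poly" where
  "bound q p = 4 + p\<^sup>2 + (q * F1 - p * G1)\<^sup>2 + (q * F2 - p * G2)\<^sup>2 + (q * F3 - p * G3)\<^sup>2"

lemma bound_ge_1: "1 \<le> poly (bound q p) x"
  by (simp add: bound_def add_increasing2)

lemma abs_less_bound: "\<bar>poly p x\<bar> < poly (bound q p) x"
proof -
  have "\<bar>poly p x\<bar> < 4 + (poly p x)\<^sup>2"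
    using abs_le_one_plus_square[of "poly p x"] by linarith
  also have "\<dots> \<le> poly (bound q p) x" by (simp add: bound_def)
  finally show ?thesis .
qed

lemma abs_form_less_bound:
  assumes "y \<noteq> 0 \<or> z \<noteq> 0" shows "\<bar>form q p x y z\<bar> < poly (bound q p) x * (y\<^sup>2 + z\<^sup>2)"
proof -
  have "\<bar>form q p x y z\<bar> \<le> (poly (bound q p) x - 1 - (poly p x)\<^sup>2) * (y\<^sup>2 + z\<^sup>2)"
    using qf_bound[of "poly (q * F1 - p * G1) x" "poly (q * F2 - p * G2) x" "poly (q * F3 - p * G3) x" y z]
    by (simp add: form_def bound_def add.assoc)
  also have "\<dots> < poly (bound q p) x * (y\<^sup>2 + z\<^sup>2)"
    using sum_squares_pos[OF assms] zero_le_power2[of "poly p x"]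
    by (intro mult_strict_right_mono) linarith+
  finally show ?thesis .
qed

text \<open>The outer pair is added to the inner one with weight u^n. For u < \<alpha> the weight is
  tiny and the inner pair prevails; for \<alpha> <= u <= 1 both contribute positively; for u > 1 the
  weight is at least 1 and the outer pair prevails.\<close>

lemma glue_good:
  assumes X: "closed X" and u: "\<And>x. x \<in> X \<Longrightarrow> 0 \<le> poly u x"
    and \<alpha>: "0 < \<alpha>" "\<alpha> < 1" and cpt: "compact (X \<inter> {x. poly u x \<le> \<alpha>})"
    and inner: "\<And>x. x \<in> X \<Longrightarrow> poly u x \<le> 1 \<Longrightarrow> good q1 p1 x"
    and outer: "\<And>x. x \<in> X \<Longrightarrow> \<alpha> \<le> poly u x \<Longrightarrow> good q0 p0 x"
  shows "\<exists>q p. \<forall>x\<in>X. good q p x"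
proof -
  have "closed (X \<inter> {x. poly u x \<le> 1})" "closed (X \<inter> {x. \<alpha> \<le> poly u x})"
    using X by (auto intro!: closed_Int closed_Collect_le continuous_intros)
  note cl = this
  obtain q p where qp: "\<And>x. x \<in> X \<Longrightarrow> poly u x \<le> 1 \<Longrightarrow> 1 \<le> poly p x"
    "\<And>x y z. x \<in> X \<Longrightarrow> poly u x \<le> 1 \<Longrightarrow> y\<^sup>2 + z\<^sup>2 \<le> form q p x y z"
  proof (rule good_scaling[OF cl(1), of q1 p1 1])
    show "good q1 p1 x" if "x \<in> X \<inter> {x. poly u x \<le> 1}" for x using inner that by simp
  next
    fix q p
    assume "\<And>x. x \<in> X \<inter> {x. poly u x \<le> 1} \<Longrightarrow> poly 1 x \<le> poly p x"
      "\<And>x y z. x \<in> X \<inter> {x. poly u x \<le> 1} \<Longrightarrow> poly 1 x * (y\<^sup>2 + z\<^sup>2) \<le> form q p x y z"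
    then show thesis by (intro that[where q = q and p = p]) simp_all
  qed
  \<comment> \<open>The inner pair is fixed by now, so the outer one can be scaled to dominate its
    \<open>bound\<close>. The reverse influence is damped by the choice of n.\<close>
  obtain q' p' where qp': "\<And>x. x \<in> X \<Longrightarrow> \<alpha> \<le> poly u x \<Longrightarrow> poly (bound q p) x \<le> poly p' x"
    "\<And>x y z. x \<in> X \<Longrightarrow> \<alpha> \<le> poly u x \<Longrightarrow> poly (bound q p) x * (y\<^sup>2 + z\<^sup>2) \<le> form q' p' x y z"
  proof (rule good_scaling[OF cl(2), of q0 p0 "bound q p"])
    show "good q0 p0 x" if "x \<in> X \<inter> {x. \<alpha> \<le> poly u x}" for x using outer that by simp
  next
    fix q' p'
    assume "\<And>x. x \<in> X \<inter> {x. \<alpha> \<le> poly u x} \<Longrightarrow> poly (bound q p) x \<le> poly p' x"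
      "\<And>x y z. x \<in> X \<inter> {x. \<alpha> \<le> poly u x} \<Longrightarrow> poly (bound q p) x * (y\<^sup>2 + z\<^sup>2) \<le> form q' p' x y z"
    then show thesis by (intro that[where q' = q' and p' = p']) simp_all
  qed
  have "compact (poly (bound q' p') ` (X \<inter> {x. poly u x \<le> \<alpha>}))"
    using cpt by (intro compact_continuous_image continuous_intros)
  then have "bounded (poly (bound q' p') ` (X \<inter> {x. poly u x \<le> \<alpha>}))" by (rule compact_imp_bounded)
  then obtain C where C: "0 < C" "\<And>x. x \<in> X \<Longrightarrow> poly u x \<le> \<alpha> \<Longrightarrow> poly (bound q' p') x \<le> C"
    unfolding bounded_pos by (auto dest: abs_le_D1)
  \<comment> \<open>On the compact region u <= \<alpha> the outer pair is bounded by C, so with this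
    weight it stays below 1, the lower bound of the inner pair.\<close>
  obtain n where n: "\<alpha> ^ n < 1 / C" using real_arch_pow_inv[of "1 / C" \<alpha>] C(1) \<alpha>(2) by auto
  define s where "s = q + u ^ n * q'"
  define r where "r = p + u ^ n * p'"
  have form_sr: "form s r x y z = form q p x y z + poly u x ^ n * form q' p' x y z" for x y z
    by (simp add: s_def r_def form_eq algebra_simps)
  have r: "poly r x = poly p x + poly u x ^ n * poly p' x" for x by (simp add: r_def)
  have "good s r x" if x: "x \<in> X" for x
  proof -
    have un: "0 \<le> poly u x ^ n" using u[OF x] by simp
    have vpos: "0 < y\<^sup>2 + z\<^sup>2" if "y \<noteq> 0 \<or> z \<noteq> 0" for y z :: real using that by (rule sum_squares_pos)
    consider "poly u x < \<alpha>" | "\<alpha> \<le> poly u x" "poly u x \<le> 1" | "1 < poly u x" by linarith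
    then show ?thesis
    proof cases
      case 1
      have "poly u x ^ n \<le> \<alpha> ^ n" using u[OF x] 1 by (intro power_mono) auto
      then have "poly u x ^ n * C \<le> \<alpha> ^ n * C" using C(1) by (intro mult_right_mono) auto
      moreover have "\<alpha> ^ n * C < 1" using n C(1) by (simp add: field_simps)
      moreover have "poly u x ^ n * poly (bound q' p') x \<le> poly u x ^ n * C"
        using C(2)[OF x] 1 un by (intro mult_left_mono) auto
      ultimately have small: "poly u x ^ n * poly (bound q' p') x < 1" by linarith
      have "poly u x ^ n * \<bar>poly p' x\<bar> \<le> poly u x ^ n * poly (bound q' p') x"
        using un abs_less_bound[of p' x q'] by (intro mult_left_mono) auto
      then have "\<bar>poly u x ^ n * poly p' x\<bar> < 1" using small un by (simp add: abs_mult)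
      then have "0 < poly r x" unfolding r using qp(1)[OF x] 1 \<alpha>(2) by linarith
      moreover have "0 < form s r x y z" if nz: "y \<noteq> 0 \<or> z \<noteq> 0" for y z
      proof -
        have "\<bar>poly u x ^ n * form q' p' x y z\<bar> \<le> (poly u x ^ n * poly (bound q' p') x) * (y\<^sup>2 + z\<^sup>2)"
          using mult_left_mono[OF less_imp_le[OF abs_form_less_bound[OF nz]] un] un by (simp add: abs_mult mult.assoc)
        also have "\<dots> < 1 * (y\<^sup>2 + z\<^sup>2)" using small vpos[OF nz] by (rule mult_strict_right_mono)
        also have "\<dots> \<le> form q p x y z" using qp(2)[OF x] 1 \<alpha>(2) by simp
        finally show ?thesis unfolding form_sr by linarith
      qed
      ultimately show ?thesis by (simp add: good_iff)
    next
      case 2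
      have "1 \<le> poly p' x" using qp'(1)[OF x 2(1)] bound_ge_1[of q p x] by linarith
      then have "0 \<le> poly u x ^ n * poly p' x" using un by simp
      then have "0 < poly r x" unfolding r using qp(1)[OF x 2(2)] by linarith
      moreover have "0 < form s r x y z" if nz: "y \<noteq> 0 \<or> z \<noteq> 0" for y z
      proof -
        have "0 \<le> poly (bound q p) x * (y\<^sup>2 + z\<^sup>2)"
          using bound_ge_1[of q p x] by (intro mult_nonneg_nonneg) auto
        then have "0 \<le> poly u x ^ n * form q' p' x y z"
          using qp'(2)[OF x 2(1), of y z] un by (intro mult_nonneg_nonneg) auto
        then show ?thesis unfolding form_sr using qp(2)[OF x 2(2), of y z] vpos[OF nz] by linarith
      qed
      ultimately show ?thesis by (simp add: good_iff)
    next
      case 3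
      have un1: "1 \<le> poly u x ^ n" using 3 by (simp add: one_le_power)
      have a: "\<alpha> \<le> poly u x" using 3 \<alpha>(2) by linarith
      have ge: "t \<le> poly u x ^ n * t" if "0 \<le> t" for t
        using mult_right_mono[OF un1 that] by simp
      have "0 \<le> poly p' x" using qp'(1)[OF x a] bound_ge_1[of q p x] by linarith
      from ge[OF this] have "0 < poly r x"
        unfolding r using qp'(1)[OF x a] abs_less_bound[of p x q] by linarith
      moreover have "0 < form s r x y z" if nz: "y \<noteq> 0 \<or> z \<noteq> 0" for y z
      proof -
        have *: "\<bar>form q p x y z\<bar> < form q' p' x y z"
          using qp'(2)[OF x a, of y z] abs_form_less_bound[OF nz, of q p x] by linarith
        then have "form q' p' x y z \<le> poly u x ^ n * form q' p' x y z" by (intro ge) linarith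
        then show ?thesis unfolding form_sr using * by linarith
      qed
      ultimately show ?thesis by (simp add: good_iff)
    qed
  qed
  then show ?thesis by blast
qed

section \<open>Solutions at a point, on intervals, near infinity and on all of
  \<open>K\<close>\<close>

lemma good_at_point:
  assumes "a \<in> K"
  obtains c where "good 1 [:c:] a"
proof -
  have "\<exists>c\<ge>0. pd (poly F1 a - c * poly G1 a) (poly F2 a - c * poly G2 a) (poly F3 a - c * poly G3 a)"
  proof (cases "0 < poly gdet a")
    case True
    then have "0 < poly fdet a" using pencil_ok_K[OF assms] by (simp add: pencil_ok_def)
    then show ?thesis
      using pd_if_multiplier_ok[OF assms multiplier_ok_one[OF pencil_ok_K[OF assms]]]
      by (intro exI[of _ 0]) simp
  next
    case False
    then obtain c where c: "0 \<le> c" "0 < poly fdet a - poly mdet a * c + poly gdet a * c\<^sup>2"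
      using pencil_ok_K[OF assms] by (auto simp only: pencil_ok_def)
    then have "multiplier_ok (poly fdet a) (poly mdet a) (poly gdet a) 1 c"
      using False by (simp add: multiplier_ok_def)
    then show ?thesis using pd_if_multiplier_ok[OF assms] c(1) by fastforce
  qed
  then obtain c where c: "0 \<le> c" and
    pd: "pd (poly F1 a - c * poly G1 a) (poly F2 a - c * poly G2 a) (poly F3 a - c * poly G3 a)" by blast
  \<comment> \<open>The multiplier c may be 0 while \<open>good\<close> asks for p > 0; positive
    definiteness survives a small increase e.\<close>
  define S where "S = {e. 0 < poly F1 a - (c + e) * poly G1 a} \<inter>
    {e. 0 < (poly F1 a - (c + e) * poly G1 a) * (poly F3 a - (c + e) * poly G3 a) - (poly F2 a - (c + e) * poly G2 a)\<^sup>2}"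
  have "open S" unfolding S_def by (intro open_Int open_Collect_less continuous_intros)
  moreover have "0 \<in> S" using pd by (simp add: S_def pd_def)
  ultimately obtain e where e: "0 < e" "cball 0 e \<subseteq> S" using open_contains_cball by blast
  then have "e \<in> S" by auto
  then have "good 1 [:c + e:] a" using c e(1) by (simp add: S_def good_def pd_def)
  then show ?thesis by (rule that)
qed

text \<open>Bisection. Intervals with a common endpoint overlap thanks to the margin e and are glued
  there. Locally, a solution at a point of K persists by openness, and near a point outside K there
  is nothing to solve.\<close>

lemma good_on_interval:
  assumes "a \<le> b"
  shows "\<exists>e>0. \<exists>q p. \<forall>x\<in>K. a - e \<le> x \<and> x \<le> b + e \<longrightarrow> good q p x"
  using assms
proof (induction a b rule: Bolzano)
  case (trans a b c)
  then obtain e1 e2 q1 p1 q2 p2 where e: "0 < e1" "0 < e2"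
    and g1: "\<And>x. x \<in> K \<Longrightarrow> a - e1 \<le> x \<Longrightarrow> x \<le> b + e1 \<Longrightarrow> good q1 p1 x"
    and g2: "\<And>x. x \<in> K \<Longrightarrow> b - e2 \<le> x \<Longrightarrow> x \<le> c + e2 \<Longrightarrow> good q2 p2 x" by metis
  define e where "e = min e1 e2"
  have e: "0 < e" "e \<le> e1" "e \<le> e2" using e by (auto simp: e_def)
  \<comment> \<open>The weight u is affine with u(A) = 0 and u(b) = 1, and the threshold is u(b -
    e). A lies left of the enlarged interval, so u is positive on it.\<close>
  define A where "A = a - e - 1"
  have A: "0 < b - e - A" "b - e - A < b - A" using trans e by (auto simp: A_def)
  define u where "u = [:- A / (b - A), 1 / (b - A):]"
  have u: "poly u x = (x - A) / (b - A)" for x by (simp add: u_def diff_divide_distrib)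
  have "\<exists>q p. \<forall>x\<in>K \<inter> {a - e..c + e}. good q p x"
  proof (rule glue_good[where u = u and \<alpha> = "(b - e - A) / (b - A)"])
    show "closed (K \<inter> {a - e..c + e})" by (intro closed_Int closed_K) simp
    show "0 \<le> poly u x" if "x \<in> K \<inter> {a - e..c + e}" for x
      using that A unfolding u by (intro divide_nonneg_nonneg) (auto simp: A_def)
    show "0 < (b - e - A) / (b - A)" "(b - e - A) / (b - A) < 1" using A by auto
    show "compact (K \<inter> {a - e..c + e} \<inter> {x. poly u x \<le> (b - e - A) / (b - A)})"
      by (intro compact_Int_closed closed_Int_compact closed_K closed_Collect_le continuous_intros) simp
    show "good q1 p1 x" if "x \<in> K \<inter> {a - e..c + e}" "poly u x \<le> 1" for x
      using that A e by (intro g1) (auto simp: u divide_le_eq)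
    show "good q2 p2 x" if "x \<in> K \<inter> {a - e..c + e}" "(b - e - A) / (b - A) \<le> poly u x" for x
      using that A e by (intro g2) (auto simp: u divide_le_cancel)
  qed
  then obtain q p where "\<forall>x\<in>K \<inter> {a - e..c + e}. good q p x" by blast
  then show ?case using e(1) by (intro exI[of _ e] conjI exI[of _ q] exI[of _ p]) auto
next
  case (local x)
  have "\<exists>q p r. 0 < r \<and> (\<forall>y\<in>K. dist x y < r \<longrightarrow> good q p y)"
  proof (cases "x \<in> K")
    case True
    then obtain c where "good 1 [:c:] x" by (rule good_at_point)
    then obtain r where "0 < r" "ball x r \<subseteq> {a. good 1 [:c:] a}"
      using open_good open_contains_ball by blast
    then show ?thesis by (metis mem_Collect_eq mem_ball subsetD)
  next
    case False
    then obtain r where "0 < r" "ball x r \<subseteq> - K"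
      using closed_K open_contains_ball[of "- K"] by auto
    then show ?thesis by (metis ComplD mem_ball subsetD)
  qed
  then obtain q p r where r: "0 < r" "\<And>y. y \<in> K \<Longrightarrow> dist x y < r \<Longrightarrow> good q p y" by blast
  show ?case
  proof (rule exI[of _ "r / 2"], intro conjI allI impI)
    fix a b assume ab: "a \<le> x \<and> x \<le> b \<and> b - a < r / 2"
    have "good q p y" if "y \<in> K" "a - r / 4 \<le> y" "y \<le> b + r / 4" for y
      by (rule r(2)[OF that(1)]) (use that ab r(1) in \<open>auto simp: dist_real_def\<close>)
    then show "\<exists>e>0. \<exists>q p. \<forall>x\<in>K. a - e \<le> x \<and> x \<le> b + e \<longrightarrow> good q p x"
      using r(1) by (intro exI[of _ "r / 4"]) auto
  qed (use r(1) in simp)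
qed

lemma good_at_infinity:
  obtains R q p where "0 < R" "\<And>x. x \<in> K \<Longrightarrow> R \<le> \<bar>x\<bar> \<Longrightarrow> good q p x"
proof -
  obtain q p where
    "\<forall>\<^sub>F x in at_top. x \<in> K \<longrightarrow> multiplier_ok (poly fdet x) (poly mdet x) (poly gdet x) (poly q x) (poly p x)"
    "\<forall>\<^sub>F x in at_bot. x \<in> K \<longrightarrow> multiplier_ok (poly fdet x) (poly mdet x) (poly gdet x) (poly q x) (poly p x)"
    using multiplier_at_ends[of K fdet mdet gdet, OF pencil_ok_K K_decided K_decided] by blast
  then obtain M N where MN:
    "\<And>x. M \<le> x \<Longrightarrow> x \<in> K \<Longrightarrow> multiplier_ok (poly fdet x) (poly mdet x) (poly gdet x) (poly q x) (poly p x)"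
    "\<And>x. x \<le> N \<Longrightarrow> x \<in> K \<Longrightarrow> multiplier_ok (poly fdet x) (poly mdet x) (poly gdet x) (poly q x) (poly p x)"
    unfolding eventually_at_top_linorder eventually_at_bot_linorder by blast
  define R where "R = max 1 (max M (- N))"
  have mult: "multiplier_ok (poly fdet x) (poly mdet x) (poly gdet x) (poly q x) (poly p x)" if "x \<in> K" "R \<le> \<bar>x\<bar>" for x
    using MN[OF _ that(1)] that(2) by (cases "0 \<le> x") (auto simp: R_def)
  have "closed (K \<inter> {x. R \<le> \<bar>x\<bar>})" by (intro closed_Int closed_K closed_Collect_le continuous_intros)
  moreover have "pd (poly (q * F1 - p * G1) x) (poly (q * F2 - p * G2) x) (poly (q * F3 - p * G3) x)"
    if "x \<in> K \<inter> {x. R \<le> \<bar>x\<bar>}" for x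
    using pd_if_multiplier_ok[OF _ mult, of x] that by simp
  \<comment> \<open>The multipliers only give p >= 0. Passing to h p + 1 adds
    \<open>form 0 1\<close>, that is -G, which a large h absorbs.\<close>
  ultimately obtain h where h: "\<And>x. 0 \<le> poly h x"
    "\<And>x y z. x \<in> K \<inter> {x. R \<le> \<bar>x\<bar>} \<Longrightarrow> poly (bound 0 1) x * (y\<^sup>2 + z\<^sup>2) \<le> poly h x * form q p x y z"
    using exists_pd_scaling[of "K \<inter> {x. R \<le> \<bar>x\<bar>}" "q * F1 - p * G1" "q * F2 - p * G2" "q * F3 - p * G3" "bound 0 1"]
    unfolding form_def by metis
  show ?thesis
  proof
    show "0 < R" by (simp add: R_def)
    fix x assume x: "x \<in> K" "R \<le> \<bar>x\<bar>"
    have "0 \<le> poly p x" using mult[OF x] by (simp add: multiplier_ok_def)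
    then have "0 < poly (h * p + 1) x" using h(1)[of x] by (simp add: add_nonneg_pos)
    moreover have "0 < form (h * q) (h * p + 1) x y z" if nz: "y \<noteq> 0 \<or> z \<noteq> 0" for y z
    proof -
      have "form (h * q) (h * p + 1) x y z = poly h x * form q p x y z + form 0 1 x y z"
        by (simp add: form_eq algebra_simps)
      then show ?thesis using h(2)[of x y z] x abs_form_less_bound[OF nz, of 0 1 x] by simp
    qed
    ultimately show "good (h * q) (h * p + 1) x" by (simp add: good_iff)
  qed
qed

lemma exists_good: "\<exists>q p. \<forall>x\<in>K. good q p x"
proof -
  obtain R q0 p0 where R: "0 < R" and g0: "\<And>x. x \<in> K \<Longrightarrow> R \<le> \<bar>x\<bar> \<Longrightarrow> good q0 p0 x"
    by (rule good_at_infinity) blast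
  have "- 2 * R \<le> 2 * R" using R by simp
  then obtain e q1 p1 where e: "0 < e"
    and "\<And>x. x \<in> K \<Longrightarrow> - 2 * R - e \<le> x \<Longrightarrow> x \<le> 2 * R + e \<Longrightarrow> good q1 p1 x"
    using good_on_interval by metis
  then have g1: "good q1 p1 x" if "x \<in> K" "\<bar>x\<bar> \<le> 2 * R" for x using that by fastforce
  \<comment> \<open>The levels 1 and 1 / 4 of u are |x| = 2 R and |x| = R, so the two solutions
    overlap for R <= |x| <= 2 R.\<close>
  define u where "u = [:0, 1 / (2 * R):]\<^sup>2"
  have u: "poly u x = (x / (2 * R))\<^sup>2" for x by (simp add: u_def)
  have u1: "poly u x \<le> 1 \<longleftrightarrow> \<bar>x\<bar> \<le> 2 * R" for x
    using R abs_le_square_iff[of "x / (2 * R)" 1] by (simp add: u abs_divide)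
  have q: "(1 / 2 :: real)\<^sup>2 = 1 / 4" by (simp add: power2_eq_square)
  have u2: "poly u x \<le> 1 / 4 \<longleftrightarrow> \<bar>x\<bar> \<le> R" for x
    using R abs_le_square_iff[of "x / (2 * R)" "1 / 2"] unfolding q by (simp add: u abs_divide divide_simps)
  have u3: "1 / 4 \<le> poly u x \<longleftrightarrow> R \<le> \<bar>x\<bar>" for x
    using R abs_le_square_iff[of "1 / 2" "x / (2 * R)"] unfolding q by (simp add: u abs_divide divide_simps)
  show ?thesis
  proof (rule glue_good[where u = u and \<alpha> = "1 / 4"])
    have "{x. poly u x \<le> 1 / 4} = {- R..R}" unfolding u2 by auto
    then show "compact (K \<inter> {x. poly u x \<le> 1 / 4})" by (simp add: closed_Int_compact closed_K)
    show "0 \<le> poly u x" for x by (simp add: u)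
    show "good q1 p1 x" if "x \<in> K" "poly u x \<le> 1" for x using g1 that u1 by blast
    show "good q0 p0 x" if "x \<in> K" "1 / 4 \<le> poly u x" for x using g0 that u3 by blast
  qed (use closed_K in auto)
qed

end

subsection \<open>The matrix identity\<close>

context positive_pencil
begin

text \<open>A point of K has a nonzero vector v with G(v) >= 0; there q F(v) > p G(v) >= 0 and F(v)
  > 0.\<close>

lemma good_imp_pos:
  assumes "a \<in> K" "good q p a" shows "0 < poly q a"
proof -
  obtain x y where xy: "x \<noteq> 0 \<or> y \<noteq> 0" "0 \<le> qf (poly G1 a) (poly G2 a) (poly G3 a) x y"
    using assms(1) qf_nonneg_somewhere_iff[of "poly G1 a" "poly G2 a" "poly G3 a"] by (auto simp: K_def)
  have p: "0 < poly p a" and "0 < form q p a x y" using assms(2) xy(1) by (auto simp: good_iff)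
  moreover have "0 \<le> poly p a * qf (poly G1 a) (poly G2 a) (poly G3 a) x y" using p xy(2) by simp
  ultimately have "0 < poly q a * qf (poly F1 a) (poly F2 a) (poly F3 a) x y" by (simp add: form_eq)
  then show ?thesis using B1[OF xy] by (simp add: zero_less_mult_iff)
qed

text \<open>From a good pair one passes to \<open>h q^2 + 1\<close> and \<open>h q p\<close>, so the
  first is positive on the whole line. The two new forms are h q times the old one plus F or F - G,
  and a large h absorbs these terms.\<close>

lemma exists_two_multipliers:
  obtains q p where "\<And>x. 0 < poly q x" "\<And>x. x \<in> K \<Longrightarrow> 0 \<le> poly p x"
    "\<And>x y z. x \<in> K \<Longrightarrow> y \<noteq> 0 \<or> z \<noteq> 0 \<Longrightarrow> 0 < form q p x y z"
    "\<And>x y z. x \<in> K \<Longrightarrow> y \<noteq> 0 \<or> z \<noteq> 0 \<Longrightarrow> 0 < form q (p + 1) x y z"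
proof -
  obtain q p where g: "\<And>x. x \<in> K \<Longrightarrow> good q p x" using exists_good by blast
  have pq: "0 < poly p x" "0 < poly q x" if "x \<in> K" for x
    using g[OF that] good_imp_pos[OF that] by (auto simp: good_def)
  have "pd (poly (q * q * F1 - q * p * G1) x) (poly (q * q * F2 - q * p * G2) x) (poly (q * q * F3 - q * p * G3) x)"
    if "x \<in> K" for x
    unfolding pd_iff form_def[symmetric]
  proof (intro allI impI)
    fix y z :: real assume "y \<noteq> 0 \<or> z \<noteq> 0"
    then have "0 < poly q x * form q p x y z" using g[OF that] pq[OF that] by (simp add: good_iff)
    then show "0 < form (q * q) (q * p) x y z" by (simp add: form_eq algebra_simps)
  qed
  then obtain h where h: "\<And>x. 0 \<le> poly h x"
    "\<And>x y z. x \<in> K \<Longrightarrow> poly (bound 1 0 + bound 0 1) x * (y\<^sup>2 + z\<^sup>2) \<le> poly h x * form (q * q) (q * p) x y z"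
    using exists_pd_scaling[OF closed_K, of "q * q * F1 - q * p * G1" "q * q * F2 - q * p * G2"
        "q * q * F3 - q * p * G3" "bound 1 0 + bound 0 1"]
    unfolding form_def by metis
  have form1: "form (h * q * q + 1) (h * q * p) x y z = poly h x * form (q * q) (q * p) x y z + form 1 0 x y z"
    and form2: "form (h * q * q + 1) (h * q * p + 1) x y z
      = poly h x * form (q * q) (q * p) x y z + form 1 0 x y z + form 0 1 x y z" for x y z
    by (simp_all add: form_eq algebra_simps)
  have dom: "\<bar>form 1 0 x y z\<bar> + \<bar>form 0 1 x y z\<bar> < poly h x * form (q * q) (q * p) x y z"
    if "x \<in> K" "y \<noteq> 0 \<or> z \<noteq> 0" for x y z
  proof -
    have "\<bar>form 1 0 x y z\<bar> + \<bar>form 0 1 x y z\<bar> < poly (bound 1 0 + bound 0 1) x * (y\<^sup>2 + z\<^sup>2)"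
      using abs_form_less_bound[OF that(2), of 1 0 x] abs_form_less_bound[OF that(2), of 0 1 x]
      by (simp add: distrib_right)
    then show ?thesis using h(2)[OF that(1), of y z] by linarith
  qed
  show ?thesis
  proof (rule that[of "h * q * q + 1" "h * q * p"])
    show "0 < poly (h * q * q + 1) x" for x
    proof -
      have "0 \<le> poly h x * (poly q x * poly q x)" using h(1)[of x] by simp
      then show ?thesis by (simp add: mult.assoc)
    qed
    show "0 \<le> poly (h * q * p) x" if "x \<in> K" for x using h(1)[of x] pq[OF that] by simp
    show "0 < form (h * q * q + 1) (h * q * p) x y z" if "x \<in> K" "y \<noteq> 0 \<or> z \<noteq> 0" for x y z
      using dom[OF that] unfolding form1 by linarith
    show "0 < form (h * q * q + 1) (h * q * p + 1) x y z" if "x \<in> K" "y \<noteq> 0 \<or> z \<noteq> 0" for x y z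
      using dom[OF that] unfolding form2 by linarith
  qed
qed

end

section \<open>Symmetric matrix polynomials and the cone attached to G\<close>

definition sym_mat :: "real poly \<Rightarrow> real poly \<Rightarrow> real poly \<Rightarrow> polymat2" where
  "sym_mat a b c = vector [vector [a, b], vector [b, c]]"

lemma sym_mat_nth [simp]:
  "sym_mat a b c $ 1 $ 1 = a" "sym_mat a b c $ 1 $ 2 = b" "sym_mat a b c $ 2 $ 1 = b" "sym_mat a b c $ 2 $ 2 = c"
  by (simp_all add: sym_mat_def)

lemma sym_mat_eqI:
  fixes A :: polymat2
  assumes "transpose A = A" shows "A = sym_mat (A $ 1 $ 1) (A $ 1 $ 2) (A $ 2 $ 2)"
proof -
  have "transpose A $ 1 $ 2 = A $ 1 $ 2" using assms by simp
  then have "A $ 2 $ 1 = A $ 1 $ 2" by (simp add: transpose_def)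
  then show ?thesis by (simp add: vec_eq_iff forall_2)
qed

lemma sym_mat_add: "sym_mat a b c + sym_mat a' b' c' = sym_mat (a + a') (b + b') (c + c')"
  by (simp add: vec_eq_iff forall_2)

lemma poly_scale_sym_mat: "f *\<^sub>p sym_mat a b c = sym_mat (f * a) (f * b) (f * c)"
  by (simp add: vec_eq_iff forall_2 poly_scale_def map_matrix_def)

lemma mat_1_sym_mat: "mat 1 = sym_mat 1 0 1"
  by (simp add: vec_eq_iff forall_2 mat_def)

lemma quad_form_mat_eval_sym_mat:
  "quad_form (mat_eval (sym_mat a b c) x) v = qf (poly a x) (poly b x) (poly c x) (v $ 1) (v $ 2)"
  by (simp add: quad_form_def mat_eval_def map_matrix_def inner_vec_def matrix_vector_mult_def sum_2
      qf_def power2_eq_square algebra_simps)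

lemma K_set_sym_mat:
  "K_set (sym_mat a b c) = {x. \<exists>y z. (y \<noteq> 0 \<or> z \<noteq> 0) \<and> 0 \<le> qf (poly a x) (poly b x) (poly c x) y z}"
proof -
  have ex: "(\<exists>v :: real ^ 2. v \<noteq> 0 \<and> P (v $ 1) (v $ 2)) \<longleftrightarrow> (\<exists>y z. (y \<noteq> 0 \<or> z \<noteq> 0) \<and> P y z)" for P
  proof
    assume "\<exists>y z. (y \<noteq> 0 \<or> z \<noteq> 0) \<and> P y z"
    then obtain y z where "y \<noteq> 0 \<or> z \<noteq> 0" "P y z" by blast
    then show "\<exists>v :: real ^ 2. v \<noteq> 0 \<and> P (v $ 1) (v $ 2)"
      by (intro exI[of _ "vector [y, z]"]) (auto simp: vec_eq_iff forall_2)
  qed (auto simp: vec_eq_iff forall_2)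
  show ?thesis unfolding K_set_def quad_form_mat_eval_sym_mat by (intro Collect_cong ex)
qed

lemma set_prod_add:
  assumes "X \<in> set_prod A B" "Y \<in> set_prod A B" shows "X + Y \<in> set_prod A B"
proof -
  obtain n a b where X: "X = (\<Sum>i<(n::nat). a i *\<^sub>p b i)" "\<forall>i<n. a i \<in> A \<and> b i \<in> B"
    using assms(1) unfolding set_prod_def by blast
  obtain m c d where Y: "Y = (\<Sum>i<(m::nat). c i *\<^sub>p d i)" "\<forall>i<m. c i \<in> A \<and> d i \<in> B"
    using assms(2) unfolding set_prod_def by blast
  define e where "e i = (if i < n then a i else c (i - n))" for i
  define f where "f i = (if i < n then b i else d (i - n))" for i
  have "(\<Sum>i<n + m. e i *\<^sub>p f i) = (\<Sum>i<n. e i *\<^sub>p f i) + (\<Sum>i=n..<n + m. e i *\<^sub>p f i)"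
    by (simp add: lessThan_atLeast0 sum.atLeastLessThan_concat)
  also have "(\<Sum>i=n..<n + m. e i *\<^sub>p f i) = (\<Sum>i<m. e (i + n) *\<^sub>p f (i + n))"
    using sum.shift_bounds_nat_ivl[of "\<lambda>i. e i *\<^sub>p f i" 0 n m] by (simp add: lessThan_atLeast0 add.commute)
  finally have "X + Y = (\<Sum>i<n + m. e i *\<^sub>p f i)" by (simp add: X Y e_def f_def)
  moreover have "\<forall>i<n + m. e i \<in> A \<and> f i \<in> B" using X Y by (auto simp: e_def f_def)
  ultimately show ?thesis unfolding set_prod_def by blast
qed

lemma set_prod_single: "a \<in> A \<Longrightarrow> b \<in> B \<Longrightarrow> a *\<^sub>p b \<in> set_prod A B"
  unfolding set_prod_def by (rule CollectI, rule exI[of _ 1], rule exI[of _ "\<lambda>_. a"], rule exI[of _ "\<lambda>_. b"]) simp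

lemma poly_scale_G_in_cone:
  assumes "a \<in> Pos (K_set G)" shows "a *\<^sub>p G \<in> set_prod (Pos (K_set G)) (N_set G)"
proof (rule set_prod_single[OF assms])
  have "0 \<in> sos_mat" unfolding sos_mat_def by (rule CollectI, rule exI[of _ 0]) simp
  moreover have "1 \<in> sos_poly" by (rule nonneg_poly_in_sos_poly) simp
  moreover have "G = 0 + 1 *\<^sub>p G" by (simp add: poly_scale_def map_matrix_def vec_eq_iff)
  ultimately show "G \<in> N_set G" unfolding N_set_def by blast
qed

lemma rank_one_in_cone:
  assumes "a \<in> Pos (K_set G)"
  shows "sym_mat (a * u\<^sup>2) (a * (u * v)) (a * v\<^sup>2) \<in> set_prod (Pos (K_set G)) (N_set G)"
proof -
  \<comment> \<open>With the single nonzero row (u, v), the square \<open>H^T H\<close> is the rank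
    one matrix of that row.\<close>
  define H :: polymat2 where "H = vector [vector [u, v], vector [0, 0]]"
  have "transpose H ** H = sym_mat (u\<^sup>2) (u * v) (v\<^sup>2)"
    by (simp add: H_def vec_eq_iff forall_2 matrix_matrix_mult_def transpose_def sum_2 power2_eq_square mult.commute)
  moreover have "transpose H ** H \<in> sos_mat"
    unfolding sos_mat_def by (rule CollectI, rule exI[of _ 1], rule exI[of _ "\<lambda>_. H"]) simp
  moreover have "0 \<in> sos_poly" by (rule nonneg_poly_in_sos_poly) simp
  moreover have "X = X + 0 *\<^sub>p G" for X by (simp add: poly_scale_def map_matrix_def vec_eq_iff)
  ultimately have "sym_mat (u\<^sup>2) (u * v) (v\<^sup>2) \<in> N_set G" unfolding N_set_def by (metis (mono_tags, lifting) mem_Collect_eq)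
  from set_prod_single[OF assms this] show ?thesis by (simp add: poly_scale_sym_mat)
qed

text \<open>For \<open>X = [[a, b], [b, c]]\<close> the identity \<open>(v\<^sup>T X v) X = (X v) (X v)\<^sup>T + det X (J v) (J v)\<^sup>T\<close>,
  with \<open>J\<close> the rotation by a right angle, is used for \<open>v = (1, 0)\<close> and \<open>v = (1, 1)\<close>, together with the
  Cayley-Hamilton identity \<open>tr X X = X\<^sup>2 + det X I\<close>. Each is multiplied by its own left-hand factor,
  so that the total factor \<open>tr(X)\<^sup>2 + a\<^sup>2 + (a + 2 b + c)\<^sup>2\<close> vanishes only where \<open>X\<close> does.\<close>

definition factor :: "real poly \<Rightarrow> real poly \<Rightarrow> real poly \<Rightarrow> real poly" where
  "factor a b c = (a + c)\<^sup>2 + a\<^sup>2 + (a + 2 * b + c)\<^sup>2"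

text \<open>The Cayley-Hamilton part contributes M tr(X) det(X) times the identity. The bound on M
  makes this coefficient at least 1 on \<open>K_set G\<close>, so I can be subtracted.\<close>

lemma factor_in_cone:
  fixes a b c :: "real poly" and M :: real
  assumes pd: "\<And>x. x \<in> K_set G \<Longrightarrow> pd (poly a x) (poly b x) (poly c x)"
    and M: "0 \<le> M" "\<And>x. x \<in> K_set G \<Longrightarrow> 1 \<le> M * poly ((a + c) * (a * c - b\<^sup>2)) x"
  defines "f \<equiv> [:M:] * factor a b c"
  shows "sym_mat (f * a - 1) (f * b) (f * c - 1) \<in> set_prod (Pos (K_set G)) (N_set G)"
    (is "_ \<in> ?C")
proof -
  define d where "d = a * c - b\<^sup>2"
  define t where "t = a + c"
  define w where "w = a + 2 * b + c"
  define m where "m = [:M:]"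
  have pos: "0 < poly a x" "0 < poly t x" "0 < poly d x" "0 < poly w x" if "x \<in> K_set G" for x
    using pd_pos[OF pd[OF that]] qf_pos[OF pd[OF that], of 1 1] by (simp_all add: d_def t_def w_def qf_def)
  have P: "m * t \<in> Pos (K_set G)" "m * t * d - 1 \<in> Pos (K_set G)" "m * a \<in> Pos (K_set G)"
    "m * a * d \<in> Pos (K_set G)" "m * w \<in> Pos (K_set G)" "m * w * d \<in> Pos (K_set G)"
    using pos[THEN less_imp_le] M
    by (auto simp: Pos_def m_def t_def[symmetric] d_def[symmetric] mult.assoc intro!: mult_nonneg_nonneg)
  note r = rank_one_in_cone[of _ G]
  \<comment> \<open>In order: the two columns of X, whose squares add up to X^2; the identity with
    coefficient lowered by 1; then X v and J v, up to sign, for v = (1, 0) and v = (1, 1).\<close>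
  note sum = set_prod_add[OF set_prod_add[OF set_prod_add[OF set_prod_add[OF set_prod_add[OF set_prod_add[OF set_prod_add[OF
    r[OF P(1), of a b] r[OF P(1), of b c]] r[OF P(2), of 1 0]] r[OF P(2), of 0 1]]
    r[OF P(3), of a b]] r[OF P(4), of 0 1]] r[OF P(5), of "a + b" "b + c"]] r[OF P(6), of 1 "-1"], unfolded sym_mat_add]
  have f: "f = m * (t\<^sup>2 + a\<^sup>2 + w\<^sup>2)" by (simp add: f_def m_def t_def w_def factor_def)
  have "f * a - 1 = m * t * a\<^sup>2 + m * t * b\<^sup>2 + (m * t * d - 1) * 1\<^sup>2 + (m * t * d - 1) * 0\<^sup>2 + m * a * a\<^sup>2 + m * a * d * 0\<^sup>2
      + m * w * (a + b)\<^sup>2 + m * w * d * 1\<^sup>2"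
    unfolding f d_def t_def w_def
    by (simp only: one_power2 zero_power2 power2_minus mult_1 mult_1_right mult_zero_right mult_zero_left add_0_right) algebra
  moreover have "f * b = m * t * (a * b) + m * t * (b * c) + (m * t * d - 1) * (1 * 0) + (m * t * d - 1) * (0 * 1)
      + m * a * (a * b) + m * a * d * (0 * 1) + m * w * ((a + b) * (b + c)) + m * w * d * (1 * - 1)"
    unfolding f d_def t_def w_def
    by (simp only: one_power2 zero_power2 power2_minus mult_1 mult_1_right mult_zero_right mult_zero_left add_0_right) algebra
  moreover have "f * c - 1 = m * t * b\<^sup>2 + m * t * c\<^sup>2 + (m * t * d - 1) * 0\<^sup>2 + (m * t * d - 1) * 1\<^sup>2 + m * a * b\<^sup>2 + m * a * d * 1\<^sup>2
      + m * w * (b + c)\<^sup>2 + m * w * d * (- 1)\<^sup>2"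
    unfolding f d_def t_def w_def
    by (simp only: one_power2 zero_power2 power2_minus mult_1 mult_1_right mult_zero_right mult_zero_left add_0_right) algebra
  ultimately show ?thesis using sum by (simp only:)
qed

lemma factor_eq_0: "poly (factor a b c) x = 0 \<Longrightarrow> poly a x = 0 \<and> poly b x = 0 \<and> poly c x = 0"
proof -
  assume "poly (factor a b c) x = 0"
  then have *: "(poly a x + poly c x)\<^sup>2 + (poly a x)\<^sup>2 + (poly a x + 2 * poly b x + poly c x)\<^sup>2 = 0"
    by (simp add: factor_def)
  then have "(poly a x + poly c x)\<^sup>2 + (poly a x)\<^sup>2 = 0" "(poly a x + 2 * poly b x + poly c x)\<^sup>2 = 0"
    by (smt (verit) zero_le_power2)+
  then show ?thesis by (auto simp: sum_power2_eq_zero_iff)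
qed

lemma factor_nonneg: "0 \<le> poly (factor a b c) x"
  by (simp add: factor_def)

text \<open>Let X = q F - p G and X' = q F - (p + 1) G have factors n and n'. Then
  \<open>M q (n + n') F = M n X + M n' X' + M (n p + n' (p + 1)) G\<close>; the first two summands
  lie in I plus the cone, the third in the cone, and the factor of F is 1 + s.\<close>

lemma sym_mat_positivstellensatz:
  fixes F1 F2 F3 G1 G2 G3 :: "real poly"
  defines "G \<equiv> sym_mat G1 G2 G3"
  assumes "positive_pencil F1 F2 F3 G1 G2 G3"
  shows "\<exists>s\<in>sos_poly. (1 + s) *\<^sub>p sym_mat F1 F2 F3 \<in> {mat 1 + H | H. H \<in> set_prod (Pos (K_set G)) (N_set G)}"
proof -
  interpret positive_pencil F1 F2 F3 G1 G2 G3 by fact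
  let ?C = "set_prod (Pos (K_set G)) (N_set G)"
  have K: "K_set G = K"
    unfolding G_def K_set_sym_mat K_def qf_nonneg_somewhere_iff by simp
  obtain q p where q: "\<And>x. 0 < poly q x" and p: "\<And>x. x \<in> K \<Longrightarrow> 0 \<le> poly p x"
    and form1: "\<And>x y z. x \<in> K \<Longrightarrow> y \<noteq> 0 \<or> z \<noteq> 0 \<Longrightarrow> 0 < form q p x y z"
    and form2: "\<And>x y z. x \<in> K \<Longrightarrow> y \<noteq> 0 \<or> z \<noteq> 0 \<Longrightarrow> 0 < form q (p + 1) x y z"
    by (rule exists_two_multipliers) blast
  define a b c where "a = q * F1 - p * G1" and "b = q * F2 - p * G2" and "c = q * F3 - p * G3"
  define a' b' c' where "a' = q * F1 - (p + 1) * G1" and "b' = q * F2 - (p + 1) * G2" and "c' = q * F3 - (p + 1) * G3"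
  note defs = a_def b_def c_def a'_def b'_def c'_def
  have pd1: "pd (poly a x) (poly b x) (poly c x)" and pd2: "pd (poly a' x) (poly b' x) (poly c' x)" if "x \<in> K" for x
    using form1[OF that] form2[OF that] unfolding pd_iff form_def defs by blast+
  define n where "n = factor a b c"
  define n' where "n' = factor a' b' c'"
  have pos1: "0 < poly (q * (n + n')) x" for x
  proof -
    have "poly n x + poly n' x \<noteq> 0"
    proof
      assume "poly n x + poly n' x = 0"
      then have "poly (factor a b c) x = 0" "poly (factor a' b' c') x = 0"
        using factor_nonneg[of a b c x] factor_nonneg[of a' b' c' x] unfolding n_def n'_def by linarith+
      note z = factor_eq_0[OF this(1)] factor_eq_0[OF this(2)]
      \<comment> \<open>A common zero of both factors is a zero of X and X', so G1 vanishes and the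
        point lies in K, where X is positive definite.\<close>
      have "poly G1 x = poly a x - poly a' x" by (simp add: defs algebra_simps)
      then have "x \<in> K" using z by (simp add: K_def)
      from pd1[OF this] show False using z by (simp add: pd_def)
    qed
    then have "0 < poly n x + poly n' x"
      using factor_nonneg[of a b c x] factor_nonneg[of a' b' c' x] unfolding n_def n'_def by linarith
    then show ?thesis using q[of x] by simp
  qed
  have pos2: "0 < poly ((a + c) * (a * c - b\<^sup>2)) x" "0 < poly ((a' + c') * (a' * c' - b'\<^sup>2)) x" if "x \<in> K" for x
    using pd_pos[OF pd1[OF that]] pd_pos[OF pd2[OF that]] by simp_all
  obtain d where d: "0 < d" "\<And>x. d \<le> poly (q * (n + n')) x"
    by (rule poly_pos_closed_lower_bound[OF closed_UNIV pos1]) auto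
  obtain d1 where d1: "0 < d1" "\<And>x. x \<in> K \<Longrightarrow> d1 \<le> poly ((a + c) * (a * c - b\<^sup>2)) x"
    by (rule poly_pos_closed_lower_bound[OF closed_K pos2(1)]) (assumption, rule that)
  obtain d2 where d2: "0 < d2" "\<And>x. x \<in> K \<Longrightarrow> d2 \<le> poly ((a' + c') * (a' * c' - b'\<^sup>2)) x"
    by (rule poly_pos_closed_lower_bound[OF closed_K pos2(2)]) (assumption, rule that)
  \<comment> \<open>One constant for three estimates: \<open>M q (n + n') >= 1\<close> on the whole
    line, and the two bounds that \<open>factor_in_cone\<close> requires.\<close>
  define M where "M = 1 / d + 1 / d1 + 1 / d2"
  have M0: "0 \<le> M" using d(1) d1(1) d2(1) by (simp add: M_def)
  have M: "1 \<le> M * t" if e: "0 < e" "1 / e \<le> M" "e \<le> t" for e t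
  proof -
    have "1 = 1 / e * e" using e(1) by simp
    also have "\<dots> \<le> M * t" using e M0 by (intro mult_mono) auto
    finally show ?thesis .
  qed
  have inv: "1 / d \<le> M" "1 / d1 \<le> M" "1 / d2 \<le> M" using d(1) d1(1) d2(1) by (simp_all add: M_def)
  define s where "s = [:M:] * (q * (n + n')) - 1"
  have "s \<in> sos_poly"
    by (rule nonneg_poly_in_sos_poly) (use M[OF d(1) inv(1) d(2)] in \<open>simp add: s_def\<close>)
  have C1: "sym_mat ([:M:] * n * a - 1) ([:M:] * n * b) ([:M:] * n * c - 1) \<in> ?C"
    unfolding n_def by (rule factor_in_cone) (use pd1 M0 M[OF d1(1) inv(2) d1(2)] K in auto)
  have C2: "sym_mat ([:M:] * n' * a' - 1) ([:M:] * n' * b') ([:M:] * n' * c' - 1) \<in> ?C"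
    unfolding n'_def by (rule factor_in_cone) (use pd2 M0 M[OF d2(1) inv(3) d2(2)] K in auto)
  have one: "1 \<in> Pos (K_set G)" by (simp add: Pos_def)
  have "[:M:] * (n * p + n' * (p + 1)) \<in> Pos (K_set G)"
    using p M0 factor_nonneg unfolding Pos_def K n_def n'_def
    by (auto intro!: mult_nonneg_nonneg add_nonneg_nonneg)
  from poly_scale_G_in_cone[OF this]
  have C3: "sym_mat ([:M:] * (n * p + n' * (p + 1)) * G1) ([:M:] * (n * p + n' * (p + 1)) * G2)
      ([:M:] * (n * p + n' * (p + 1)) * G3) \<in> ?C"
    unfolding G_def poly_scale_sym_mat .
  define H where "H = sym_mat ((1 + s) * F1 - 1) ((1 + s) * F2) ((1 + s) * F3 - 1)"
  have "H \<in> ?C"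
  proof -
    \<comment> \<open>\<open>C1\<close> and \<open>C2\<close> subtract the identity twice but H only
      once, so one identity is added back as two rank one squares.\<close>
    note set_prod_add[OF set_prod_add[OF set_prod_add[OF set_prod_add[OF C1 C2] C3]
        rank_one_in_cone[OF one, of 1 0]] rank_one_in_cone[OF one, of 0 1], unfolded sym_mat_add]
    moreover have "(1 + s) * F1 - 1 = [:M:] * n * a - 1 + ([:M:] * n' * a' - 1) + [:M:] * (n * p + n' * (p + 1)) * G1 + 1 * 1\<^sup>2 + 1 * 0\<^sup>2"
      unfolding s_def defs
      by (simp only: one_power2 zero_power2 power2_minus mult_1 mult_1_right mult_zero_right mult_zero_left add_0_right) algebra
    moreover have "(1 + s) * F2 = [:M:] * n * b + [:M:] * n' * b' + [:M:] * (n * p + n' * (p + 1)) * G2 + 1 * (1 * 0) + 1 * (0 * 1)"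
      unfolding s_def defs
      by (simp only: one_power2 zero_power2 power2_minus mult_1 mult_1_right mult_zero_right mult_zero_left add_0_right) algebra
    moreover have "(1 + s) * F3 - 1 = [:M:] * n * c - 1 + ([:M:] * n' * c' - 1) + [:M:] * (n * p + n' * (p + 1)) * G3 + 1 * 0\<^sup>2 + 1 * 1\<^sup>2"
      unfolding s_def defs
      by (simp only: one_power2 zero_power2 power2_minus mult_1 mult_1_right mult_zero_right mult_zero_left add_0_right) algebra
    ultimately show ?thesis unfolding H_def by (simp only:)
  qed
  moreover have "(1 + s) *\<^sub>p sym_mat F1 F2 F3 = mat 1 + H"
    by (simp add: poly_scale_sym_mat mat_1_sym_mat H_def sym_mat_add)
  ultimately show ?thesis using \<open>s \<in> sos_poly\<close> by blast
qed

theorem proposition5p4: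
  fixes F G :: "real poly ^ 2 ^ 2"
  assumes symF: "transpose F = F"
    and symG: "transpose G = G"
    and B1: "\<forall>a::real. \<forall>v::real ^ 2. v \<noteq> 0 \<longrightarrow>
      quad_form (mat_eval G a) v \<ge> 0 \<longrightarrow> quad_form (mat_eval F a) v > 0"
  shows "\<exists>s\<in>sos_poly. (1 + s) *\<^sub>p F \<in> {mat 1 + H | H. H \<in> set_prod (Pos (K_set G)) (N_set G)}"
proof -
  define F' where "F' = sym_mat (F $ 1 $ 1) (F $ 1 $ 2) (F $ 2 $ 2)"
  define G' where "G' = sym_mat (G $ 1 $ 1) (G $ 1 $ 2) (G $ 2 $ 2)"
  have FG: "F = F'" "G = G'" unfolding F'_def G'_def using sym_mat_eqI symF symG by blast+
  have "positive_pencil (F $ 1 $ 1) (F $ 1 $ 2) (F $ 2 $ 2) (G $ 1 $ 1) (G $ 1 $ 2) (G $ 2 $ 2)"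
  proof
    fix a y z :: real
    assume nz: "y \<noteq> 0 \<or> z \<noteq> 0" and G: "0 \<le> qf (poly (G $ 1 $ 1) a) (poly (G $ 1 $ 2) a) (poly (G $ 2 $ 2) a) y z"
    have "vector [y, z] \<noteq> (0 :: real ^ 2)" using nz by (auto simp: vec_eq_iff forall_2)
    then have "quad_form (mat_eval G' a) (vector [y, z]) \<ge> 0 \<Longrightarrow> quad_form (mat_eval F' a) (vector [y, z]) > 0"
      using B1 unfolding FG[symmetric] by blast
    then show "0 < qf (poly (F $ 1 $ 1) a) (poly (F $ 1 $ 2) a) (poly (F $ 2 $ 2) a) y z"
      using G by (simp add: F'_def G'_def quad_form_mat_eval_sym_mat)
  qed
  from sym_mat_positivstellensatz[OF this] show ?thesis
    unfolding F'_def[symmetric] G'_def[symmetric] FG[symmetric] .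
qed

end
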